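(* Let $(U,\partial,\mu)$ be an associative, homotopy commutative (differential graded) algebra over a field of characteristic zero. Let $\overline\mu(u,v):=\tfrac12(\mu(u,v)+\mu(v,u))$ be the symmetrization of $\mu$ (with the Koszul sign $(-1)^{\deg u\cdot\deg v}$ understood in the second term). Then $\overline\mu$ can be extended to a balanced $A(\infty)$-structure on $(U,\partial)$, i.e. there is a balanced $A(\infty)$-algebra $(U,\partial,n_2,n_3,\dots)$ with $n_2=\overline\mu$.
   Context: Homotopy commutative means that $\mu$ and $\mu\circ\tau$, $\tau$ the (Koszul-signed) interchange of factors, are chain homotopic chain maps $U\otimes U\to U$. Differentials have degree $-1$. An $A(\infty)$-algebra is $(W,\partial,n_2,n_3,\dots)$ with $(W,\partial)$ a chain complex and $n_i:W^{\otimes i}\to W$ of degree $i-2$ such that for all $n\ge2$, with $\delta$ the induced differential on $\mathrm{Hom}(W^{\otimes n},W)$ and Koszul signs, $$\delta(n_n)=\sum_{i+j=n+1,\ i,j\ge2}\ \sum_{s=0}^{n-j}(-1)^{i+s(j+1)}\,n_i(1^{\otimes s}\otimes n_j\otimes1^{\otimes i-s-1}).$$ It is balanced (a $C(\infty)$-algebra) if each $n_i$ vanishes on all signed shuffles $\sum_\sigma\mathrm{sgn}(\sigma)\,(\text{Koszul sign})\,w_{\sigma^{-1}(1)}\otimes\dots\otimes w_{\sigma^{-1}(i)}$, the sum over all $(p,i-p)$-shuffles, $1\le p\le i-1$. *)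

theory Defs
  imports Complex_Main "HOL-Combinatorics.Permutations"
begin

text \<open>
  A linear map on a tensor power of a graded vector space \<open>U\<close> is represented by a multilinear
  function on lists of the corresponding length. Formulas involving Koszul signs are stated on
  lists \<open>ws\<close> of homogeneous elements, together with a list \<open>ps\<close> of their degrees; by
  multilinearity this determines both sides. (An entry \<open>0\<close> has every degree, but then both sides
  vanish.)
\<close>

locale graded_vector_space = vector_space scale
  for scale :: "'k::field \<Rightarrow> 'u::ab_group_add \<Rightarrow> 'u" (infixr \<open>*s\<close> 75) +
  fixes U :: "int \<Rightarrow> 'u set"
  assumes subspace_component: "subspace (U p)"
    and direct_sum:
      "\<exists>!c. (\<forall>p. c p \<in> U p) \<and> finite {p. c p \<noteq> 0} \<and> (\<Sum>p | c p \<noteq> 0. c p) = x"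
begin

definition homogeneous :: "int list \<Rightarrow> 'u list \<Rightarrow> bool" where
  "homogeneous ps ws \<longleftrightarrow> list_all2 (\<lambda>p w. w \<in> U p) ps ws"

definition multilinear :: "nat \<Rightarrow> ('u list \<Rightarrow> 'u) \<Rightarrow> bool" where
  "multilinear m f \<longleftrightarrow>
    (\<forall>ws k. length ws = m \<longrightarrow> k < m \<longrightarrow> Vector_Spaces.linear scale scale (\<lambda>x. f (ws[k := x])))"

definition graded_multilinear :: "nat \<Rightarrow> int \<Rightarrow> ('u list \<Rightarrow> 'u) \<Rightarrow> bool" where
  "graded_multilinear m e f \<longleftrightarrow> multilinear m f \<and>
    (\<forall>ps ws. length ws = m \<longrightarrow> homogeneous ps ws \<longrightarrow> f ws \<in> U (sum_list ps + e))"

definition graded_bilinear :: "int \<Rightarrow> ('u \<Rightarrow> 'u \<Rightarrow> 'u) \<Rightarrow> bool" where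
  "graded_bilinear e f \<longleftrightarrow>
    (\<forall>u. Vector_Spaces.linear scale scale (f u)) \<and>
    (\<forall>v. Vector_Spaces.linear scale scale (\<lambda>u. f u v)) \<and>
    (\<forall>p q. \<forall>u\<in>U p. \<forall>v\<in>U q. f u v \<in> U (p + q + e))"

text \<open>
  The value on \<open>ws\<close> of \<open>f (1\<^sup>\<otimes>\<^sup>s \<otimes> g \<otimes> 1 \<otimes> \<dots> \<otimes> 1)\<close>, where \<open>g\<close> has \<open>j\<close> arguments and degree \<open>e\<close>:
  moving \<open>g\<close> past the first \<open>s\<close> arguments produces the Koszul sign.
\<close>

definition insertion ::
  "nat \<Rightarrow> nat \<Rightarrow> int \<Rightarrow> ('u list \<Rightarrow> 'u) \<Rightarrow> ('u list \<Rightarrow> 'u) \<Rightarrow> int list \<Rightarrow> 'u list \<Rightarrow> 'u" where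
  "insertion s j e f g ps ws =
    (-1) powi (e * sum_list (take s ps)) *s
      f (take s ws @ [g (take j (drop s ws))] @ drop (s + j) ws)"

definition koszul_sign :: "(nat \<Rightarrow> nat) \<Rightarrow> int list \<Rightarrow> 'k" where
  "koszul_sign \<sigma> ps =
    (\<Prod>(a, b) \<in> {(a, b). a < b \<and> b < length ps \<and> \<sigma> b < \<sigma> a}. (-1) powi (ps ! a * ps ! b))"

end

text \<open>Positions are numbered from \<open>0\<close>, so the two blocks are \<open>{..<p}\<close> and \<open>{p..<i}\<close>.\<close>

definition shuffles_of :: "nat \<Rightarrow> nat \<Rightarrow> (nat \<Rightarrow> nat) set" where
  "shuffles_of p i =
    {\<sigma>. \<sigma> permutes {..<i} \<and> strict_mono_on {..<p} \<sigma> \<and> strict_mono_on {p..<i} \<sigma>}"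

locale graded_chain_complex = graded_vector_space scale U
  for scale :: "'k::field \<Rightarrow> 'u::ab_group_add \<Rightarrow> 'u" (infixr \<open>*s\<close> 75)
    and U :: "int \<Rightarrow> 'u set" +
  fixes d :: "'u \<Rightarrow> 'u"
  assumes linear_d: "Vector_Spaces.linear scale scale d"
    and degree_d: "u \<in> U p \<Longrightarrow> d u \<in> U (p - 1)"
    and d_d: "d (d u) = 0"
begin

text \<open>
  The value on \<open>ws\<close> of the induced differential \<open>d f - (-1)\<^sup>e f d\<close> of a multilinear map \<open>f\<close> of
  degree \<open>e\<close>, where the second \<open>d\<close> is the differential of the tensor power.
\<close>

definition hom_differential :: "int \<Rightarrow> ('u list \<Rightarrow> 'u) \<Rightarrow> int list \<Rightarrow> 'u list \<Rightarrow> 'u" where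
  "hom_differential e f ps ws =
    d (f ws) - (-1) powi e *s
      (\<Sum>k<length ws. (-1) powi (sum_list (take k ps)) *s f (ws[k := d (ws ! k)]))"

end

locale associative_dg_algebra = graded_chain_complex scale U d
  for scale :: "'k::field \<Rightarrow> 'u::ab_group_add \<Rightarrow> 'u" (infixr \<open>*s\<close> 75)
    and U :: "int \<Rightarrow> 'u set" and d :: "'u \<Rightarrow> 'u" +
  fixes \<mu> :: "'u \<Rightarrow> 'u \<Rightarrow> 'u"
  assumes graded_bilinear_mult: "graded_bilinear 0 \<mu>"
    and leibniz: "u \<in> U p \<Longrightarrow> d (\<mu> u v) = \<mu> (d u) v + (-1) powi p *s \<mu> u (d v)"
    and assoc: "\<mu> (\<mu> u v) w = \<mu> u (\<mu> v w)"

text \<open>The map \<open>h\<close> is a chain homotopy: \<open>d h + h d = \<mu> - \<mu> \<tau>\<close> on \<open>U \<otimes> U\<close>.\<close>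

locale homotopy_commutative_dg_algebra = associative_dg_algebra +
  assumes homotopy_commutative:
    "\<exists>h. graded_bilinear 1 h \<and>
      (\<forall>p q. \<forall>u\<in>U p. \<forall>v\<in>U q.
        d (h u v) + (h (d u) v + (-1) powi p *s h u (d v))
          = \<mu> u v - (-1) powi (p * q) *s \<mu> v u)"

text \<open>Only the operations \<open>n i\<close> with \<open>i \<ge> 2\<close> are part of the structure.\<close>

locale A_infinity_algebra = graded_chain_complex scale U d
  for scale :: "'k::field \<Rightarrow> 'u::ab_group_add \<Rightarrow> 'u" (infixr \<open>*s\<close> 75)
    and U :: "int \<Rightarrow> 'u set" and d :: "'u \<Rightarrow> 'u" +
  fixes n :: "nat \<Rightarrow> 'u list \<Rightarrow> 'u"
  assumes graded_multilinear_op: "2 \<le> i \<Longrightarrow> graded_multilinear i (int i - 2) (n i)"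
    and A_infinity: "2 \<le> m \<Longrightarrow> length ws = m \<Longrightarrow> homogeneous ps ws \<Longrightarrow>
      hom_differential (int m - 2) (n m) ps ws =
        (\<Sum>(i, j) \<in> {(i, j). i + j = m + 1 \<and> 2 \<le> i \<and> 2 \<le> j}. \<Sum>s = 0..m - j.
          (-1) ^ (i + s * (j + 1)) *s insertion s j (int j - 2) (n i) (n j) ps ws)"

locale balanced_A_infinity_algebra = A_infinity_algebra +
  assumes balanced:
    "2 \<le> i \<Longrightarrow> 1 \<le> p \<Longrightarrow> p \<le> i - 1 \<Longrightarrow> length ws = i \<Longrightarrow> homogeneous ps ws \<Longrightarrow>
      (\<Sum>\<sigma> \<in> shuffles_of p i.
        (of_int (sign \<sigma>) * koszul_sign \<sigma> ps) *s n i (map (\<lambda>k. ws ! inv \<sigma> k) [0..<i])) = 0"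

text \<open>
  The symmetrization of \<open>\<mu>\<close> evaluated at \<open>u\<close> of degree \<open>p\<close> and \<open>v\<close> of degree \<open>q\<close>.
\<close>

definition symmetrization ::
  "('k::field \<Rightarrow> 'u::ab_group_add \<Rightarrow> 'u) \<Rightarrow> ('u \<Rightarrow> 'u \<Rightarrow> 'u) \<Rightarrow> int \<Rightarrow> int \<Rightarrow> 'u \<Rightarrow> 'u \<Rightarrow> 'u" where
  "symmetrization scale \<mu> p q u v =
    scale (1 / 2) (\<mu> u v + scale ((-1) powi (p * q)) (\<mu> v u))"

end

theory Submission
  imports Defs
begin

text \<open>
  Over a field, homotopy commutativity says that the homology of \<open>U\<close> is graded commutative, and
  \<open>U\<close> retracts onto its homology up to homotopy. The extension of the symmetrized product is
  obtained from the product of the homology, which is strictly commutative and associative and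
  therefore a balanced structure with zero higher operations.

  A degree-one map \<open>K\<close> with \<open>d K d = d\<close> gives the chain map \<open>P = 1 - d K - K d\<close>. It is homotopic to
  the identity, takes values in cycles and kills boundaries, hence replaces every cycle by a
  representative of its class that depends on the class only. Write \<open>m\<close> for the symmetrization of
  \<open>\<mu>\<close> and put \<open>\<nu> = P m (P \<otimes> P)\<close>. This product is graded commutative, annihilates boundaries, has
  values in cycles, and is associative, because on cycles \<open>m\<close> and \<open>\<mu>\<close> differ by boundaries
  (\<open>strict_square\<close>). Homotopies transported along \<open>P\<close> produce a graded symmetric
  map \<open>G\<close> of degree one whose differential is \<open>m - \<nu>\<close> (\<open>\<delta>_G\<close>). So \<open>m\<close> is the binary operation of
  a structure that is gauge equivalent to \<open>\<nu>\<close>.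

  The gauge transformation takes place in the suspended setting, where a structure is one odd
  cochain \<open>b\<close>, with components of all arities, such that \<open>b \<circ> b = 0\<close> for the insertion
  product. With \<open>b\<close> the differential plus \<open>\<nu>\<close> and \<open>[x, G] = x \<circ> G - G \<circ> x\<close>, the series
  \<open>b + [b, G] + [[b, G], G] / 2! + \<dots>\<close> is finite on each word because \<open>G\<close> raises arity, and its square
  vanishes again (\<open>transform_square\<close>). Two algebraic facts carry this part. The insertion product
  is pre-Lie (\<open>coderiv_pre_Lie\<close>), which makes bracketing with \<open>G\<close> compatible with the square.
  Insertion of a cochain that vanishes on shuffles is a derivation of the shuffle product
  (\<open>shuffle_coderiv\<close>), so cochains that vanish on shuffles are closed under insertion and the
  series stays balanced.

  It remains to remove the suspension. The sign by which a cochain on suspended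
  words differs from the operation on \<open>U\<close> turns \<open>b \<circ> b = 0\<close> into the relations of an
  \<open>A(\<infinity>)\<close>-algebra (\<open>A_infinity_desuspend\<close>) and recursive shuffles into sums over shuffle permutations
  with the sign of the permutation (\<open>sum_shuffles_of\<close>).
\<close>

section \<open>Words, insertions and shuffles\<close>

text \<open>
  The sign \<open>(-1)\<^sup>q\<close> acts on any abelian group, so that the combinatorial part is free of scalars.
\<close>

definition signed :: "int \<Rightarrow> 'a::ab_group_add \<Rightarrow> 'a" where
  "signed q x = (if even q then x else - x)"

lemma signed_simps [simp]:
  "signed 0 x = x" "signed q 0 = 0" "signed q (- x) = - signed q x"
  "signed q (signed r x) = signed (q + r) x"
  by (auto simp: signed_def)

lemma signed_add: "signed q (x + y) = signed q x + signed q y"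
  by (auto simp: signed_def)

lemma signed_diff: "signed q (x - y) = signed q x - signed q y"
  by (auto simp: signed_def)

lemma signed_cong: "even (q - r) \<Longrightarrow> signed q x = signed r x"
  by (auto simp: signed_def)

lemma signed_sum: "signed q (\<Sum>i\<in>I. f i) = (\<Sum>i\<in>I. signed q (f i))"
  by (auto simp: signed_def sum_negf)

text \<open>
  A word is a tensor of elements that carry their degrees along. In a word, degrees are those of
  the suspension: an element of \<open>U p\<close> has degree \<open>p + 1\<close>. Membership is not built in: the
  identities for insertions and shuffles hold for arbitrary letters, and membership enters only
  through \<open>hom_word\<close> below.
\<close>

type_synonym 'u word = "(int \<times> 'u) list"

definition deg :: "'u word \<Rightarrow> int" where "deg ws = sum_list (map fst ws)"

lemma deg_simps [simp]: "deg [] = 0" "deg (w # ws) = fst w + deg ws" "deg (a @ b) = deg a + deg b"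
  by (auto simp: deg_def)

definition out :: "int \<Rightarrow> ('u word \<Rightarrow> 'u) \<Rightarrow> 'u word \<Rightarrow> int \<times> 'u" where
  "out e f ws = (deg ws + e, f ws)"

lemma fst_out [simp]: "fst (out e f ws) = deg ws + e"
  by (simp add: out_def)

fun deconcat :: "('u word \<Rightarrow> 'u word \<Rightarrow> 'v::ab_group_add) \<Rightarrow> 'u word \<Rightarrow> 'v" where
  "deconcat \<psi> [] = \<psi> [] []"
| "deconcat \<psi> (w # ws) = \<psi> [] (w # ws) + deconcat (\<lambda>a b. \<psi> (w # a) b) ws"

text \<open>
  The composite of \<open>\<phi>\<close> with the coderivation that a cochain \<open>f\<close> of degree \<open>e\<close> cogenerates, denoted
  \<open>\<phi> \<circ> f\<close> below: \<open>f\<close> replaces each nonempty block in turn and is moved there past the preceding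
  letters. Both this and the shuffle product act on functionals by recursion on the first
  letter, which spares formal sums of words.
\<close>

fun coderiv :: "int \<Rightarrow> ('u word \<Rightarrow> 'u) \<Rightarrow> ('u word \<Rightarrow> 'v::ab_group_add) \<Rightarrow> 'u word \<Rightarrow> 'v" where
  "coderiv e f \<phi> [] = 0"
| "coderiv e f \<phi> (w # ws) = deconcat (\<lambda>a b. \<phi> (out e f (w # a) # b)) ws
     + signed (e * fst w) (coderiv e f (\<lambda>v. \<phi> (w # v)) ws)"

text \<open>
  The value of \<open>\<phi>\<close> on the shuffle product of two words, with Koszul signs only: the sign of the
  permutation is absorbed by the suspension.
\<close>

fun shuffle :: "('u word \<Rightarrow> 'v::ab_group_add) \<Rightarrow> 'u word \<Rightarrow> 'u word \<Rightarrow> 'v" where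
  "shuffle \<phi> [] ys = \<phi> ys"
| "shuffle \<phi> (x # xs) [] = \<phi> (x # xs)"
| "shuffle \<phi> (x # xs) (y # ys) = shuffle (\<lambda>v. \<phi> (x # v)) xs (y # ys)
     + signed (fst y * deg (x # xs)) (shuffle (\<lambda>v. \<phi> (y # v)) (x # xs) ys)"

definition slot_additive :: "(('u::ab_group_add) word \<Rightarrow> 'v::ab_group_add) \<Rightarrow> bool" where
  "slot_additive \<phi> \<longleftrightarrow>
    (\<forall>a q x y b. \<phi> (a @ (q, x + y) # b) = \<phi> (a @ (q, x) # b) + \<phi> (a @ (q, y) # b))"

lemma deconcat_cong:
  "(\<And>a b. ws = a @ b \<Longrightarrow> \<psi> a b = \<psi>' a b) \<Longrightarrow> deconcat \<psi> ws = deconcat \<psi>' ws"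
proof (induction ws arbitrary: \<psi> \<psi>')
  case (Cons w ws)
  have "\<psi> (w # a) b = \<psi>' (w # a) b" if "ws = a @ b" for a b
    using Cons.prems[of "w # a" b] that by simp
  then have "deconcat (\<lambda>a. \<psi> (w # a)) ws = deconcat (\<lambda>a. \<psi>' (w # a)) ws"
    by (rule Cons.IH)
  moreover have "\<psi> [] (w # ws) = \<psi>' [] (w # ws)" using Cons.prems[of "[]"] by simp
  ultimately show ?case by simp
qed simp

lemma coderiv_cong:
  "(\<And>a u b. ws = a @ u @ b \<Longrightarrow> u \<noteq> [] \<Longrightarrow> \<phi> (a @ out e f u # b) = \<psi> (a @ out e' f' u # b)) \<Longrightarrow>
    even (e - e') \<Longrightarrow> coderiv e f \<phi> ws = coderiv e' f' \<psi> ws"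
proof (induction ws arbitrary: \<phi> \<psi>)
  case (Cons w ws)
  have 1: "coderiv e f (\<lambda>v. \<phi> (w # v)) ws = coderiv e' f' (\<lambda>v. \<psi> (w # v)) ws"
  proof (rule Cons.IH)
    fix a u b assume "ws = a @ u @ b" "u \<noteq> []"
    then show "\<phi> (w # a @ out e f u # b) = \<psi> (w # a @ out e' f' u # b)"
      using Cons.prems(1)[of "w # a" u b] by simp
  qed (rule Cons.prems(2))
  have 2: "deconcat (\<lambda>a b. \<phi> (out e f (w # a) # b)) ws
      = deconcat (\<lambda>a b. \<psi> (out e' f' (w # a) # b)) ws"
  proof (rule deconcat_cong)
    fix a b assume "ws = a @ b"
    then show "\<phi> (out e f (w # a) # b) = \<psi> (out e' f' (w # a) # b)"
      using Cons.prems(1)[of "[]" "w # a" b] by simp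
  qed
  have "even (e * fst w - e' * fst w)" using Cons.prems(2) by (metis dvd_mult2 left_diff_distrib)
  then have "signed (e * fst w) x = signed (e' * fst w) x" for x :: 'b by (rule signed_cong)
  then show ?case by (simp only: coderiv.simps 1 2)
qed simp

lemma shuffle_cong:
  "(\<And>v. mset v = mset xs + mset ys \<Longrightarrow> \<phi> v = \<psi> v) \<Longrightarrow> shuffle \<phi> xs ys = shuffle \<psi> xs ys"
proof (induction \<phi> xs ys arbitrary: \<psi> rule: shuffle.induct)
  case (3 \<phi> x xs y ys)
  have "shuffle (\<lambda>v. \<phi> (x # v)) xs (y # ys) = shuffle (\<lambda>v. \<psi> (x # v)) xs (y # ys)"
    "shuffle (\<lambda>v. \<phi> (y # v)) (x # xs) ys = shuffle (\<lambda>v. \<psi> (y # v)) (x # xs) ys"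
    using 3 by auto
  then show ?case by simp
qed auto

lemma shuffle_Nil2 [simp]: "shuffle \<phi> xs [] = \<phi> xs"
  by (cases xs) auto

lemma deconcat_add: "deconcat (\<lambda>a b. \<psi> a b + \<psi>' a b) ws = deconcat \<psi> ws + deconcat \<psi>' ws"
  by (induction ws arbitrary: \<psi> \<psi>') auto

lemma deconcat_signed: "deconcat (\<lambda>a b. signed q (\<psi> a b)) ws = signed q (deconcat \<psi> ws)"
  by (induction ws arbitrary: \<psi>) (auto simp: signed_add)

lemma deconcat_0 [simp]: "deconcat (\<lambda>a b. 0) ws = 0"
  by (induction ws) auto

lemma coderiv_add: "coderiv e f (\<lambda>v. \<phi> v + \<psi> v) ws = coderiv e f \<phi> ws + coderiv e f \<psi> ws"
  by (induction ws arbitrary: \<phi> \<psi>) (auto simp: deconcat_add signed_add)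

lemma coderiv_signed: "coderiv e f (\<lambda>v. signed q (\<phi> v)) ws = signed q (coderiv e f \<phi> ws)"
  by (induction ws arbitrary: \<phi>) (auto simp: deconcat_signed signed_add ac_simps)

lemma coderiv_0 [simp]: "coderiv e f (\<lambda>v. 0) ws = 0"
  by (induction ws) auto

lemma shuffle_add: "shuffle (\<lambda>v. \<phi> v + \<psi> v) xs ys = shuffle \<phi> xs ys + shuffle \<psi> xs ys"
  by (induction \<phi> xs ys arbitrary: \<psi> rule: shuffle.induct) (auto simp: signed_add)

lemma shuffle_signed: "shuffle (\<lambda>v. signed q (\<phi> v)) xs ys = signed q (shuffle \<phi> xs ys)"
  by (induction \<phi> xs ys rule: shuffle.induct) (auto simp: signed_add ac_simps)

lemma shuffle_0 [simp]: "shuffle (\<lambda>v. 0) xs ys = 0"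
  using shuffle_add[of "\<lambda>v. 0" "\<lambda>v. 0" xs ys] by simp

lemma additive_deconcat:
  assumes "\<And>x y. L (x + y) = L x + L y"
  shows "L (deconcat \<psi> ws) = deconcat (\<lambda>a b. L (\<psi> a b)) ws"
  by (induction ws arbitrary: \<psi>) (auto simp: assms)

lemma additive_signed:
  fixes L :: "'a::ab_group_add \<Rightarrow> 'b::ab_group_add"
  assumes "\<And>x y. L (x + y) = L x + L y"
  shows "L (signed q x) = signed q (L x)"
proof -
  have "L 0 = 0" using assms[of 0 0] by simp
  then have "L (- x) = - L x" using assms[of x "- x"] by (simp add: eq_neg_iff_add_eq_0 add.commute)
  then show ?thesis by (simp add: signed_def)
qed

lemma additive_coderiv:
  fixes L :: "'a::ab_group_add \<Rightarrow> 'b::ab_group_add"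
  assumes "\<And>x y. L (x + y) = L x + L y"
  shows "L (coderiv e f \<phi> ws) = coderiv e f (\<lambda>v. L (\<phi> v)) ws"
proof (induction ws arbitrary: \<phi>)
  case Nil
  show ?case using assms[of 0 0] by simp
qed (auto simp: assms additive_deconcat[where L = L, OF assms] additive_signed[where L = L, OF assms])

lemma additive_shuffle:
  fixes L :: "'a::ab_group_add \<Rightarrow> 'b::ab_group_add"
  assumes "\<And>x y. L (x + y) = L x + L y"
  shows "L (shuffle \<phi> xs ys) = shuffle (\<lambda>v. L (\<phi> v)) xs ys"
  by (induction \<phi> xs ys rule: shuffle.induct)
    (auto simp: assms additive_signed[where L = L, OF assms])

lemma deconcat_coassoc:
  "deconcat (\<lambda>a b. deconcat (\<lambda>a1 a2. \<chi> a1 a2 b) a) ws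
    = deconcat (\<lambda>a1 c. deconcat (\<lambda>a2 b. \<chi> a1 a2 b) c) ws"
  by (induction ws arbitrary: \<chi>) (auto simp: deconcat_add ac_simps)

text \<open>
  A coderivation is compatible with deconcatenation: the inserted block lies either in the first
  factor or in the second, where it has been moved past the first.
\<close>

lemma coderiv_deconcat:
  "coderiv e f (\<lambda>v. deconcat \<psi> v) ws
    = deconcat (\<lambda>a b. coderiv e f (\<lambda>a'. \<psi> a' b) a + signed (e * deg a) (coderiv e f (\<psi> a) b)) ws"
proof (induction ws arbitrary: \<psi>)
  case (Cons w ws)
  show ?case
    by (simp add: Cons.IH coderiv_add deconcat_add signed_add deconcat_coassoc
        distrib_left ac_simps flip: deconcat_signed)
qed simp

section \<open>The pre-Lie identity\<close>

lemma slot_additiveD: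
  "slot_additive \<phi> \<Longrightarrow> \<phi> (a @ (q, x + y) # b) = \<phi> (a @ (q, x) # b) + \<phi> (a @ (q, y) # b)"
  "slot_additive \<phi> \<Longrightarrow> \<phi> ((q, x + y) # b) = \<phi> ((q, x) # b) + \<phi> ((q, y) # b)"
  unfolding slot_additive_def by (metis append_Nil)+

lemma slot_additive_Cons: "slot_additive \<phi> \<Longrightarrow> slot_additive (\<lambda>v. \<phi> (w # v))"
  unfolding slot_additive_def by (metis append_Cons)

lemma coderiv_out:
  assumes "slot_additive \<phi>"
  shows "coderiv e' g (\<lambda>a'. \<phi> (out e f (w # a') # b)) a
    = \<phi> ((fst w + deg a + e + e', coderiv e' g (\<lambda>v. f (w # v)) a) # b)"
proof -
  have "coderiv e' g (\<lambda>a'. \<phi> (out e f (w # a') # b)) a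
      = coderiv e' g (\<lambda>a'. \<phi> ((fst w + deg a + e + e', f (w # a')) # b)) a"
    by (rule coderiv_cong) (auto simp: out_def ac_simps)
  also have "\<dots> = \<phi> ((fst w + deg a + e + e', coderiv e' g (\<lambda>v. f (w # v)) a) # b)"
    by (rule additive_coderiv[symmetric]) (rule slot_additiveD(2)[OF assms])
  finally show ?thesis .
qed

lemma deconcat_out:
  assumes "slot_additive \<phi>"
  shows "deconcat (\<lambda>a1 a2. \<phi> (out e f (out e' g (w # a1) # a2) # b)) a
    = \<phi> ((fst w + deg a + e + e', deconcat (\<lambda>a1 a2. f (out e' g (w # a1) # a2)) a) # b)"
proof -
  have "deconcat (\<lambda>a1 a2. \<phi> (out e f (out e' g (w # a1) # a2) # b)) a
      = deconcat (\<lambda>a1 a2. \<phi> ((fst w + deg a + e + e', f (out e' g (w # a1) # a2)) # b)) a"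
    by (rule deconcat_cong) (auto simp: out_def ac_simps)
  also have "\<dots> = \<phi> ((fst w + deg a + e + e', deconcat (\<lambda>a1 a2. f (out e' g (w # a1) # a2)) a) # b)"
    by (rule additive_deconcat[symmetric]) (rule slot_additiveD(2)[OF assms])
  finally show ?thesis .
qed

text \<open>
  In \<open>(\<phi> \<circ> f) \<circ> g - \<phi> \<circ> (f \<circ> g)\<close> the nested insertions cancel and the disjoint ones remain. Of
  these, the first two sums involve the first letter of the word: the block at the front is
  filled by \<open>g\<close> in one and by \<open>f\<close> in the other. Exchanging \<open>f\<close> and \<open>g\<close> swaps the two sums up to
  a sign.
\<close>

lemma coderiv_coderiv_Cons:
  assumes "slot_additive \<phi>"
  shows "coderiv e' g (coderiv e f \<phi>) (w # ws) - coderiv (e + e') (coderiv e' g f) \<phi> (w # ws)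
    = deconcat (\<lambda>a b. signed (e * (fst w + deg a + e')) (coderiv e f (\<lambda>v. \<phi> (out e' g (w # a) # v)) b)) ws
    + deconcat (\<lambda>a b. signed (e' * (fst w + deg a)) (coderiv e' g (\<lambda>v. \<phi> (out e f (w # a) # v)) b)) ws
    + signed ((e + e') * fst w) (coderiv e' g (coderiv e f (\<lambda>v. \<phi> (w # v))) ws
        - coderiv (e + e') (coderiv e' g f) (\<lambda>v. \<phi> (w # v)) ws)"
proof -
  have 1: "\<phi> (out (e + e') (coderiv e' g f) (w # a) # b)
      = deconcat (\<lambda>a1 a2. \<phi> (out e f (out e' g (w # a1) # a2) # b)) a
      + signed (e' * fst w) (coderiv e' g (\<lambda>a'. \<phi> (out e f (w # a') # b)) a)" for a b
    unfolding coderiv_out[OF assms] deconcat_out[OF assms]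
    by (simp add: out_def additive_signed[where L = "\<lambda>x. \<phi> ((_, x) # b)", symmetric]
        slot_additiveD(2)[OF assms] ac_simps)
  show ?thesis
    by (simp add: 1 coderiv_add deconcat_add signed_add signed_diff coderiv_deconcat
        coderiv_signed deconcat_coassoc distrib_left distrib_right ac_simps flip: deconcat_signed)
qed

text \<open>
  The associator of the insertion product is graded symmetric in its last two arguments, since it
  counts insertions at two disjoint places.
\<close>

theorem coderiv_pre_Lie:
  assumes "slot_additive \<phi>"
  shows "coderiv e' g (coderiv e f \<phi>) ws - coderiv (e + e') (coderiv e' g f) \<phi> ws
    = signed (e * e') (coderiv e f (coderiv e' g \<phi>) ws - coderiv (e + e') (coderiv e f g) \<phi> ws)"
  using assms
proof (induction ws arbitrary: \<phi>)
  case (Cons w ws)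
  have IH: "coderiv e' g (coderiv e f (\<lambda>v. \<phi> (w # v))) ws
        - coderiv (e + e') (coderiv e' g f) (\<lambda>v. \<phi> (w # v)) ws
      = signed (e * e') (coderiv e f (coderiv e' g (\<lambda>v. \<phi> (w # v))) ws
        - coderiv (e + e') (coderiv e f g) (\<lambda>v. \<phi> (w # v)) ws)"
    by (rule Cons.IH[OF slot_additive_Cons[OF Cons.prems]])
  have s: "signed (e * (e' + r)) x = signed (e * e' + e * r) x"
     "signed (r + (t + e * (e' * 2))) x = signed (r + t) x" for r t and x :: 'b
    by (auto simp: distrib_left signed_def)
  have c: "coderiv (e' + e) = coderiv (e + e')" by (simp add: add.commute)
  show ?case
    unfolding coderiv_coderiv_Cons[OF Cons.prems] IH
      coderiv_coderiv_Cons[OF Cons.prems, of e f e' g, unfolded c]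
    by (simp add: signed_add signed_diff distrib_left distrib_right s ac_simps
         flip: deconcat_signed)
qed simp

section \<open>Coderivations and the shuffle product\<close>

text \<open>
  Deconcatenation is multiplicative for the shuffle product: tensor coalgebras are bialgebras.
\<close>

lemma shuffle_deconcat:
  "shuffle (\<lambda>v. deconcat \<psi> v) xs ys
    = deconcat (\<lambda>x1 x2. deconcat (\<lambda>y1 y2. signed (deg x2 * deg y1)
        (shuffle (\<lambda>a. shuffle (\<lambda>b. \<psi> a b) x2 y2) x1 y1)) ys) xs"
proof (induction xs arbitrary: \<psi> ys)
  case outer: (Cons x xs)
  show ?case
  proof (induction ys arbitrary: \<psi>)
    case inner: (Cons y ys)
    show ?case
      by (simp add: shuffle_add outer.IH inner.IH deconcat_add signed_add distrib_left distrib_right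
          ac_simps flip: deconcat_signed)
        (rule deconcat_cong, auto simp: distrib_left distrib_right ac_simps)
  qed simp
qed simp

text \<open>
  The balanced cochains (Harrison cochains).
\<close>

definition shuffle_free :: "('u word \<Rightarrow> 'v::ab_group_add) \<Rightarrow> bool" where
  "shuffle_free f \<longleftrightarrow> (\<forall>xs ys. xs \<noteq> [] \<longrightarrow> ys \<noteq> [] \<longrightarrow> shuffle f xs ys = 0)"

lemma deconcat_only_Nil: "deconcat (\<lambda>a b. if a = [] then \<chi> b else 0) ws = \<chi> ws"
  by (cases ws) auto

lemma deconcat_if_Nil_Cons:
  "deconcat (\<lambda>a b. if a = [] then 0 else \<chi> a b) (w # ws) = deconcat (\<lambda>a b. \<chi> (w # a) b) ws"
  by simp

text \<open>
  Inserting \<open>f\<close> into an initial block of a shuffle: that block is itself a shuffle of initial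
  blocks of \<open>xs\<close> and \<open>ys\<close>, and \<open>f\<close> vanishes unless one of these is empty.
\<close>

lemma shuffle_deconcat_out:
  assumes f: "shuffle_free f" and \<phi>: "slot_additive \<phi>"
  shows "shuffle (deconcat (\<lambda>a b. if a = [] then 0 else \<phi> (out e f a # b))) xs ys
    = deconcat (\<lambda>a b. if a = [] then 0 else shuffle (\<lambda>v. \<phi> (out e f a # v)) b ys) xs
    + deconcat (\<lambda>a b. if a = [] then 0 else
        signed (deg xs * deg a) (shuffle (\<lambda>v. \<phi> (out e f a # v)) xs b)) ys"
proof -
  have inner: "signed (deg x2 * deg y1)
        (shuffle (\<lambda>a. shuffle (\<lambda>b. if a = [] then 0 else \<phi> (out e f a # b)) x2 y2) x1 y1)
     = (if x1 = [] then if y1 = [] then 0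
          else signed (deg x2 * deg y1) (shuffle (\<lambda>v. \<phi> (out e f y1 # v)) x2 y2)
        else if y1 = [] then shuffle (\<lambda>v. \<phi> (out e f x1 # v)) x2 y2 else 0)" (is "signed _ ?l = ?r") for x1 x2 y1 y2
  proof (cases "x1 = [] \<or> y1 = []")
    case False
    \<comment> \<open>All shuffles of the initial blocks have the same degree, so their values under \<open>f\<close> can be added up in one slot.\<close>
    let ?L = "\<lambda>u. shuffle (\<lambda>b. \<phi> ((deg x1 + deg y1 + e, u) # b)) x2 y2"
    have "?l = shuffle (\<lambda>a. ?L (f a)) x1 y1"
    proof (rule shuffle_cong)
      fix v assume v: "mset v = mset x1 + mset y1"
      then have "sum_mset (image_mset fst (mset v)) = sum_mset (image_mset fst (mset x1 + mset y1))"
        by simp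
      then have "deg v = deg x1 + deg y1"
        by (simp add: deg_def flip: sum_mset_sum_list)
      moreover have "v \<noteq> []" using v False by auto
      ultimately show "shuffle (\<lambda>b. if v = [] then 0 else \<phi> (out e f v # b)) x2 y2 = ?L (f v)"
        by (simp add: out_def)
    qed
    also have "\<dots> = ?L (shuffle f x1 y1)"
      by (rule additive_shuffle[where L = ?L, symmetric])
        (simp add: slot_additiveD(2)[OF \<phi>] shuffle_add)
    also have "shuffle f x1 y1 = 0" using f False by (simp add: shuffle_free_def)
    also have "?L 0 = 0"
      using slot_additiveD(2)[OF \<phi>, of _ 0 0] by simp
    finally show ?thesis using False by simp
  qed auto
  have split: "(if x1 = [] then if y1 = [] then 0 else s2 else if y1 = [] then s1 else 0)
     = (if x1 = [] then if y1 = [] then 0 else s2 else 0) + (if y1 = [] then if x1 = [] then 0 else s1 else 0)"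
    for x1 y1 :: "'a word" and s1 s2 :: 'b by simp
  have if_deconcat: "deconcat (\<lambda>a b. if P then \<chi> a b else 0) ws = (if P then deconcat \<chi> ws else 0)"
    for P and \<chi> :: "'a word \<Rightarrow> 'a word \<Rightarrow> 'b" and ws by simp
  show ?thesis
    unfolding shuffle_deconcat inner split signed_add deconcat_add if_deconcat deconcat_only_Nil
    by (subst add.commute) (simp add: deconcat_only_Nil)
qed

lemma coderiv_Cons_deconcat:
  "coderiv e f \<phi> (w # ws) = deconcat (\<lambda>a b. if a = [] then 0 else \<phi> (out e f a # b)) (w # ws)
    + signed (e * fst w) (coderiv e f (\<lambda>v. \<phi> (w # v)) ws)"
  by simp

lemma coderiv_signed_deg:
  "coderiv e f (\<lambda>v. signed (k * (r + deg v)) (\<phi> v)) ws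
    = signed (k * (r + deg ws + e)) (coderiv e f \<phi> ws)"
proof -
  have "coderiv e f (\<lambda>v. signed (k * (r + deg v)) (\<phi> v)) ws
      = coderiv e f (\<lambda>v. signed (k * (r + deg ws + e)) (\<phi> v)) ws"
    by (rule coderiv_cong) (auto simp: ac_simps)
  then show ?thesis by (simp add: coderiv_signed)
qed

text \<open>
  The coderivation of a balanced cochain is a derivation of the shuffle product. In the induction
  the words that start with the inserted block are handled by \<open>shuffle_deconcat_out\<close>.
\<close>

theorem shuffle_coderiv:
  assumes f: "shuffle_free f" and "slot_additive \<phi>"
  shows "shuffle (coderiv e f \<phi>) xs ys
    = coderiv e f (\<lambda>v. shuffle \<phi> v ys) xs + signed (e * deg xs) (coderiv e f (\<lambda>v. shuffle \<phi> xs v) ys)"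
  using assms(2)
proof (induction xs arbitrary: \<phi> ys)
  case outer: (Cons x xs)
  show ?case using outer.prems
  proof (induction ys arbitrary: \<phi>)
    case inner: (Cons y ys)
    note x = outer.IH[OF slot_additive_Cons[OF inner.prems]]
    note y = inner.IH[OF slot_additive_Cons[OF inner.prems]]
    have "shuffle (coderiv e f \<phi>) (x # xs) (y # ys)
      = shuffle (deconcat (\<lambda>a b. if a = [] then 0 else \<phi> (out e f a # b))) (x # xs) (y # ys)
       + (signed (e * fst x) (shuffle (coderiv e f (\<lambda>v. \<phi> (x # v))) xs (y # ys))
       + signed (fst y * deg (x # xs) + e * fst y) (shuffle (coderiv e f (\<lambda>v. \<phi> (y # v))) (x # xs) ys))"
      unfolding shuffle.simps(3)[of "coderiv e f \<phi>"]
        shuffle.simps(3)[of "deconcat (\<lambda>a b. if a = [] then 0 else \<phi> (out e f a # b))"]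
      unfolding coderiv_Cons_deconcat
      by (simp only: shuffle_add shuffle_signed signed_add signed_simps ac_simps)
    also have "\<dots> = coderiv e f (\<lambda>v. shuffle \<phi> v (y # ys)) (x # xs)
        + signed (e * deg (x # xs)) (coderiv e f (\<lambda>v. shuffle \<phi> (x # xs) v) (y # ys))"
    proof -
      have lx: "coderiv e f (\<lambda>v. shuffle \<phi> v (y # ys)) (x # xs)
        = deconcat (\<lambda>a b. shuffle (\<lambda>v. \<phi> (out e f (x # a) # v)) b (y # ys)) xs
        + signed (e * fst x) (coderiv e f (\<lambda>v. shuffle (\<lambda>v. \<phi> (x # v)) v (y # ys)) xs)
        + signed (fst y * (deg (x # xs) + e)) (coderiv e f (\<lambda>v. shuffle (\<lambda>v. \<phi> (y # v)) v ys) (x # xs))"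
      proof -
        have 1: "deconcat (\<lambda>a b. signed (fst y * (fst x + deg a + e + deg b))
              (shuffle (\<lambda>v. \<phi> (y # v)) (out e f (x # a) # b) ys)) xs
           = signed (fst y * (deg (x # xs) + e))
               (deconcat (\<lambda>a b. shuffle (\<lambda>v. \<phi> (y # v)) (out e f (x # a) # b) ys) xs)"
          unfolding deconcat_signed[symmetric] by (rule deconcat_cong) (simp add: ac_simps)
        have "coderiv e f (\<lambda>v. shuffle \<phi> v (y # ys)) (x # xs)
          = deconcat (\<lambda>a b. shuffle (\<lambda>v. \<phi> (out e f (x # a) # v)) b (y # ys)
              + signed (fst y * (fst x + deg a + e + deg b))
                  (shuffle (\<lambda>v. \<phi> (y # v)) (out e f (x # a) # b) ys)) xs
          + signed (e * fst x) (coderiv e f (\<lambda>v. shuffle (\<lambda>v. \<phi> (x # v)) v (y # ys)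
              + signed (fst y * (fst x + deg v)) (shuffle (\<lambda>v. \<phi> (y # v)) (x # v) ys)) xs)"
          by (simp add: ac_simps)
        then show ?thesis
          unfolding deconcat_add coderiv_add 1 coderiv_signed_deg coderiv.simps(2)[of e f "\<lambda>v. shuffle (\<lambda>v. \<phi> (y # v)) v ys"]
          by (simp add: signed_add ac_simps)
      qed
      have ly: "coderiv e f (\<lambda>v. shuffle \<phi> (x # xs) v) (y # ys)
        = deconcat (\<lambda>a b. signed ((fst y + deg a + e) * deg (x # xs))
            (shuffle (\<lambda>v. \<phi> (out e f (y # a) # v)) (x # xs) b)) ys
        + coderiv e f (\<lambda>v. shuffle (\<lambda>v. \<phi> (x # v)) xs v) (y # ys)
        + signed (e * fst y + fst y * deg (x # xs)) (coderiv e f (\<lambda>v. shuffle (\<lambda>v. \<phi> (y # v)) (x # xs) v) ys)"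
        by (simp add: deconcat_add coderiv_add signed_add coderiv_signed ac_simps)
      show ?thesis
        unfolding shuffle_deconcat_out[OF f inner.prems] deconcat_if_Nil_Cons x y lx ly
        by (simp only: signed_add signed_simps deg_simps distrib_left distrib_right ac_simps
           flip: deconcat_signed) (simp add: signed_def)
    qed
    finally show ?case .
  qed simp
next
  case Nil
  have "shuffle \<phi> [] = \<phi>" by (rule ext) simp
  then show ?case by simp
qed

lemma coderiv_eq_0:
  assumes "\<And>a u b. ws = a @ u @ b \<Longrightarrow> u \<noteq> [] \<Longrightarrow> \<phi> (a @ out e f u # b) = 0"
  shows "coderiv e f \<phi> ws = 0"
  using coderiv_cong[of ws \<phi> e f "\<lambda>v. 0" e f] assms by simp

text \<open>
  By the derivation property, \<open>g \<circ> f\<close> on a shuffle is \<open>g\<close> on shuffles of words that are still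
  nonempty.
\<close>

lemma shuffle_free_coderiv:
  assumes f: "shuffle_free f" and g: "shuffle_free g" "slot_additive g"
  shows "shuffle_free (coderiv e f g)"
proof -
  have "shuffle (coderiv e f g) xs ys = 0" if "xs \<noteq> []" "ys \<noteq> []" for xs ys
  proof -
    have "coderiv e f (\<lambda>v. shuffle g v ys) xs = 0" "coderiv e f (\<lambda>v. shuffle g xs v) ys = 0"
      by (rule coderiv_eq_0; use that g in \<open>simp add: shuffle_free_def\<close>)+
    then show ?thesis by (simp add: shuffle_coderiv[OF f g(2)])
  qed
  then show ?thesis by (simp add: shuffle_free_def)
qed

lemma length_shuffle_cong:
  assumes "\<And>v. length v = length xs + length ys \<Longrightarrow> \<phi> v = \<psi> v"
  shows "shuffle \<phi> xs ys = shuffle \<psi> xs ys"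
  by (rule shuffle_cong) (metis assms mset_append size_mset length_append)

section \<open>Linear and homogeneous cochains\<close>

context graded_vector_space
begin

abbreviation lin :: "('u \<Rightarrow> 'u) \<Rightarrow> bool" where
  "lin f \<equiv> Vector_Spaces.linear scale scale f"

lemma linear_pair: "vector_space_pair scale scale"
  by (intro vector_space_pair.intro vector_space_axioms)

lemma lin_iff: "lin f \<longleftrightarrow> (\<forall>x y. f (x + y) = f x + f y) \<and> (\<forall>c x. f (scale c x) = scale c (f x))"
  unfolding Vector_Spaces.linear_iff using vector_space_axioms by blast

lemma linD:
  assumes "lin f"
  shows "f (x + y) = f x + f y" "f (scale c x) = scale c (f x)" "f 0 = 0"
    "f (- x) = - f x" "f (x - y) = f x - f y" "f (signed q x) = signed q (f x)"
    "f (\<Sum>i\<in>I. h i) = (\<Sum>i\<in>I. f (h i))"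
proof -
  interpret vector_space_pair scale scale by (rule linear_pair)
  show "f (x + y) = f x + f y" "f (scale c x) = scale c (f x)" "f 0 = 0"
    "f (- x) = - f x" "f (x - y) = f x - f y"
    "f (\<Sum>i\<in>I. h i) = (\<Sum>i\<in>I. f (h i))"
    using linear_add[OF assms] linear_scale[OF assms] linear_0[OF assms] linear_neg[OF assms]
      linear_diff[OF assms] linear_sum[OF assms] by auto
  then show "f (signed q x) = signed q (f x)" by (simp add: signed_def)
qed

lemma signed_scale: "signed q (scale c x) = scale c (signed q x)"
  by (simp add: signed_def)

lemma lin_intros:
  "lin (\<lambda>x. x)" "lin (\<lambda>x. 0)"
  "lin f \<Longrightarrow> lin g \<Longrightarrow> lin (\<lambda>x. f x + g x)"
  "lin f \<Longrightarrow> lin g \<Longrightarrow> lin (\<lambda>x. f x - g x)"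
  "lin f \<Longrightarrow> lin (\<lambda>x. scale c (f x))"
  "lin f \<Longrightarrow> lin (\<lambda>x. signed q (f x))"
  "(\<And>i. i \<in> I \<Longrightarrow> lin (h i)) \<Longrightarrow> lin (\<lambda>x. \<Sum>i\<in>I. h i x)"
  subgoal by (simp add: lin_iff)
  subgoal by (simp add: lin_iff)
  subgoal by (simp add: lin_iff scale_right_distrib ac_simps)
  subgoal by (simp add: lin_iff scale_right_diff_distrib)
  subgoal by (simp add: lin_iff scale_right_distrib mult.commute)
  subgoal by (simp add: lin_iff signed_add signed_scale)
  subgoal by (simp add: lin_iff sum.distrib scale_sum_right)
  done

lemma lin_compose: "lin f \<Longrightarrow> lin g \<Longrightarrow> lin (\<lambda>x. f (g x))"
  by (simp add: lin_iff)

definition slot_linear :: "('u word \<Rightarrow> 'u) \<Rightarrow> bool" where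
  "slot_linear \<phi> \<longleftrightarrow> (\<forall>a q b. lin (\<lambda>x. \<phi> (a @ (q, x) # b)))"

lemma slot_linearD: "slot_linear \<phi> \<Longrightarrow> lin (\<lambda>x. \<phi> (a @ (q, x) # b))"
  by (simp add: slot_linear_def)

lemma slot_linear_hd: "slot_linear \<phi> \<Longrightarrow> lin (\<lambda>x. \<phi> ((q, x) # b))"
  using slot_linearD[of \<phi> "[]"] by simp

lemma slot_linear_Cons: "slot_linear \<phi> \<Longrightarrow> slot_linear (\<lambda>v. \<phi> (w # v))"
  using slot_linearD[of \<phi> "w # _"] by (simp add: slot_linear_def)

lemma slot_linear_additive: "slot_linear \<phi> \<Longrightarrow> slot_additive \<phi>"
  using linD(1)[OF slot_linearD] by (simp add: slot_additive_def)

lemma slot_linear_zero: "slot_linear \<phi> \<Longrightarrow> f u = 0 \<Longrightarrow> \<phi> (a @ out e f u # b) = 0"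
  using linD(3)[OF slot_linearD] by (simp add: out_def)

lemma lin_deconcat: "(\<And>a b. lin (\<lambda>x. \<psi> x a b)) \<Longrightarrow> lin (\<lambda>x. deconcat (\<psi> x) ws)"
proof (induction ws arbitrary: \<psi>)
  case (Cons w ws)
  show ?case unfolding deconcat.simps by (intro lin_intros Cons)
qed simp

lemma lin_coderiv: "(\<And>v. lin (\<lambda>x. \<phi> x v)) \<Longrightarrow> lin (\<lambda>x. coderiv e f (\<phi> x) ws)"
proof (induction ws arbitrary: \<phi>)
  case (Cons w ws)
  show ?case unfolding coderiv.simps by (intro lin_intros lin_deconcat Cons)
qed (simp add: lin_intros(2))

lemma lin_deconcat_slot:
  assumes "\<And>a a' b. lin (\<lambda>x. \<psi> (a @ (q, x) # a') b)" "\<And>a b b'. lin (\<lambda>x. \<psi> a (b @ (q, x) # b'))"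
  shows "lin (\<lambda>x. deconcat \<psi> (ws @ (q, x) # ws'))"
  using assms
proof (induction ws arbitrary: \<psi>)
  case Nil
  have "lin (\<lambda>x. deconcat (\<lambda>a. \<psi> ((q, x) # a)) ws')"
    by (rule lin_deconcat) (rule Nil(1)[of "[]", simplified])
  then show ?case using Nil(2)[of "[]" "[]"] by (simp add: lin_intros(3))
next
  case (Cons w ws)
  have "lin (\<lambda>x. deconcat (\<lambda>a. \<psi> (w # a)) (ws @ (q, x) # ws'))"
    by (rule Cons.IH, rule Cons.prems(1)[of "w # _", simplified], rule Cons.prems(2))
  then show ?case using Cons.prems(2)[of "[]" "w # ws"] by (simp add: lin_intros(3))
qed

lemma slot_linear_coderiv:
  assumes f: "slot_linear f" and "slot_linear \<phi>"
  shows "slot_linear (coderiv e f \<phi>)"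
proof -
  have "lin (\<lambda>x. coderiv e f \<phi> (a @ (q, x) # b))" if "slot_linear \<phi>" for a q b \<phi>
    using that
  proof (induction a arbitrary: \<phi>)
    case Nil
    have 1: "lin (\<lambda>x. \<phi> (out e f ((q, x) # c) # d))" for c d
      unfolding out_def deg_simps fst_conv
      by (rule lin_compose[OF slot_linear_hd[OF Nil] slot_linear_hd[OF f]])
    then show ?case
      by (auto intro!: lin_intros lin_deconcat lin_coderiv slot_linear_hd[OF Nil])
  next
    case (Cons w a)
    have 1: "lin (\<lambda>x. \<phi> (out e f (w # c @ (q, x) # c') # d))" for c c' d
      unfolding out_def deg_simps fst_conv
      by (rule lin_compose[OF slot_linear_hd[OF Cons.prems] slot_linearD[OF f, of "w # c", simplified]])
    have 2: "lin (\<lambda>x. \<phi> (z # c @ (q, x) # d))" for z c d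
      using slot_linearD[OF Cons.prems, of "z # c"] by simp
    show ?case
      by (auto intro!: lin_intros lin_deconcat_slot 1 2 Cons.IH slot_linear_Cons[OF Cons.prems])
  qed
  then show ?thesis using assms by (simp add: slot_linear_def)
qed

lemma slot_linear_diff: "slot_linear f \<Longrightarrow> slot_linear g \<Longrightarrow> slot_linear (\<lambda>v. f v - g v)"
  unfolding slot_linear_def by (intro allI lin_intros) auto

lemma slot_linear_scale: "slot_linear f \<Longrightarrow> slot_linear (\<lambda>v. scale c (f v))"
  unfolding slot_linear_def by (intro allI lin_intros) auto

lemma coderiv_sum: "coderiv e f (\<lambda>v. \<Sum>i\<in>I. \<phi> i v) ws = (\<Sum>i\<in>I. coderiv e f (\<phi> i) ws)"
  by (induction I rule: infinite_finite_induct) (simp_all add: coderiv_add)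

lemma coderiv_diff: "coderiv e f (\<lambda>v. \<phi> v - \<psi> v) ws = coderiv e f \<phi> ws - coderiv e f \<psi> ws"
  using coderiv_add[of e f "\<lambda>v. \<phi> v - \<psi> v" \<psi> ws] by simp

lemma coderiv_scale: "coderiv e f (\<lambda>v. scale c (\<phi> v)) ws = scale c (coderiv e f \<phi> ws)"
  by (rule additive_coderiv[where L = "scale c", symmetric]) (rule scale_right_distrib)

lemma coderiv_op_add:
  assumes "slot_linear \<phi>"
  shows "coderiv e (\<lambda>u. f u + g u) \<phi> ws = coderiv e f \<phi> ws + coderiv e g \<phi> ws"
  using assms
proof (induction ws arbitrary: \<phi>)
  case (Cons w ws)
  show ?case
    using Cons.IH[OF slot_linear_Cons[OF Cons.prems]]
    by (simp add: out_def linD(1)[OF slot_linear_hd[OF Cons.prems]] deconcat_add signed_add)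
qed simp

lemma coderiv_op_scale:
  assumes "slot_linear \<phi>"
  shows "coderiv e (\<lambda>u. scale c (f u)) \<phi> ws = scale c (coderiv e f \<phi> ws)"
  using assms
proof (induction ws arbitrary: \<phi>)
  case (Cons w ws)
  show ?case
    using Cons.IH[OF slot_linear_Cons[OF Cons.prems]]
    by (simp add: out_def linD(2)[OF slot_linear_hd[OF Cons.prems]] scale_right_distrib signed_scale
        additive_deconcat[where L = "scale c"])
qed simp

lemma coderiv_op_0: "slot_linear \<phi> \<Longrightarrow> coderiv e (\<lambda>u. 0) \<phi> ws = 0"
  by (rule coderiv_eq_0) (simp add: slot_linear_zero)

lemma coderiv_op_sum:
  "slot_linear \<phi> \<Longrightarrow> coderiv e (\<lambda>u. \<Sum>i\<in>I. f i u) \<phi> ws = (\<Sum>i\<in>I. coderiv e (f i) \<phi> ws)"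
  by (induction I rule: infinite_finite_induct) (simp_all add: coderiv_op_add coderiv_op_0)

lemma coderiv_op_diff:
  assumes "slot_linear \<phi>"
  shows "coderiv e (\<lambda>u. f u - g u) \<phi> ws = coderiv e f \<phi> ws - coderiv e g \<phi> ws"
  using coderiv_op_add[OF assms, of e "\<lambda>u. f u - g u" g ws] by simp

text \<open>
  The shift by one undoes the suspension of the degree that is stored with each letter.
\<close>

definition hom_word :: "'u word \<Rightarrow> bool" where
  "hom_word ws \<longleftrightarrow> (\<forall>w \<in> set ws. snd w \<in> U (fst w - 1))"

lemma hom_word_simps [simp]:
  "hom_word []" "hom_word (w # ws) \<longleftrightarrow> snd w \<in> U (fst w - 1) \<and> hom_word ws"
  "hom_word (a @ b) \<longleftrightarrow> hom_word a \<and> hom_word b"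
  by (auto simp: hom_word_def)

definition graded_cochain :: "int \<Rightarrow> ('u word \<Rightarrow> 'u) \<Rightarrow> bool" where
  "graded_cochain e f \<longleftrightarrow> (\<forall>ws. hom_word ws \<longrightarrow> ws \<noteq> [] \<longrightarrow> f ws \<in> U (deg ws + e - 1))"

lemma hom_word_out: "graded_cochain e f \<Longrightarrow> hom_word u \<Longrightarrow> u \<noteq> [] \<Longrightarrow> snd (out e f u) \<in> U (deg u + e - 1)"
  by (simp add: graded_cochain_def out_def)

lemma signed_in_U [simp]: "x \<in> U p \<Longrightarrow> signed q x \<in> U p"
  by (simp add: signed_def subspace_neg[OF subspace_component])

lemma coderiv_mem:
  fixes ws :: "'u word"
  assumes "subspace V" "\<And>a u b. ws = a @ u @ b \<Longrightarrow> u \<noteq> [] \<Longrightarrow> \<phi> (a @ out e f u # b) \<in> V"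
  shows "coderiv e f \<phi> ws \<in> V"
proof -
  have d: "deconcat \<psi> ws \<in> V" if "\<And>a b. ws = a @ b \<Longrightarrow> \<psi> a b \<in> V" for \<psi> and ws :: "'u word"
    using that
  proof (induction ws arbitrary: \<psi>)
    case (Cons w ws)
    have "deconcat (\<lambda>a. \<psi> (w # a)) ws \<in> V" by (rule Cons.IH) (simp add: Cons.prems)
    then show ?case using Cons.prems[of "[]"] subspace_add[OF assms(1)] by simp
  qed simp
  show ?thesis using assms(2)
  proof (induction ws arbitrary: \<phi>)
    case Nil
    show ?case using subspace_0[OF assms(1)] by simp
  next
    case (Cons w ws)
    have "coderiv e f (\<lambda>v. \<phi> (w # v)) ws \<in> V"
      by (rule Cons.IH) (metis Cons.prems append_Cons)
    then have "signed (e * fst w) (coderiv e f (\<lambda>v. \<phi> (w # v)) ws) \<in> V"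
      using subspace_neg[OF assms(1)] by (simp add: signed_def)
    moreover have "deconcat (\<lambda>a b. \<phi> (out e f (w # a) # b)) ws \<in> V"
    proof (rule d)
      fix a b assume "ws = a @ b"
      then show "\<phi> (out e f (w # a) # b) \<in> V" using Cons.prems[of "[]" "w # a" b] by simp
    qed
    ultimately show ?case using subspace_add[OF assms(1)] by simp
  qed
qed

lemma graded_cochain_coderiv:
  assumes f: "graded_cochain e f" and g: "graded_cochain e' g"
  shows "graded_cochain (e + e') (coderiv e f g)"
  unfolding graded_cochain_def
proof (intro allI impI)
  fix ws :: "'u word" assume ws: "hom_word ws"
  show "coderiv e f g ws \<in> U (deg ws + (e + e') - 1)"
  proof (rule coderiv_mem[OF subspace_component])
    fix a u b assume s: "ws = a @ u @ b" "u \<noteq> []"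
    then have "hom_word (a @ out e f u # b)"
      using ws hom_word_out[OF f, of u] by simp
    then show "g (a @ out e f u # b) \<in> U (deg ws + (e + e') - 1)"
      using g[unfolded graded_cochain_def, rule_format, of "a @ out e f u # b"] s
      by (simp add: algebra_simps)
  qed
qed

end

context graded_vector_space
begin

lemma shuffle_scale: "shuffle (\<lambda>v. scale c (\<phi> v)) xs ys = scale c (shuffle \<phi> xs ys)"
  by (rule additive_shuffle[where L = "scale c", symmetric]) (rule scale_right_distrib)

lemma shuffle_free_diff:
  assumes "shuffle_free f" "shuffle_free g"
  shows "shuffle_free (\<lambda>v. f v - g v :: 'u)"
proof -
  have "shuffle (\<lambda>v. f v - g v) xs ys = shuffle f xs ys - shuffle g xs ys" for xs ys
    using shuffle_add[of "\<lambda>v. f v - g v" g xs ys] by simp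
  then show ?thesis using assms by (simp add: shuffle_free_def)
qed

lemma shuffle_free_scale: "shuffle_free f \<Longrightarrow> shuffle_free (\<lambda>v. scale c (f v))"
  by (simp add: shuffle_free_def shuffle_scale)

lemma graded_cochain_diff:
  "graded_cochain e f \<Longrightarrow> graded_cochain e g \<Longrightarrow> graded_cochain e (\<lambda>v. f v - g v)"
  by (simp add: graded_cochain_def subspace_diff[OF subspace_component])

lemma graded_cochain_scale: "graded_cochain e f \<Longrightarrow> graded_cochain e (\<lambda>v. scale c (f v))"
  by (simp add: graded_cochain_def subspace_scale[OF subspace_component])

end

section \<open>Gauge transformations of balanced structures\<close>

text \<open>
  A structure \<open>m\<close>, that is, a Maurer-Cartan element, and an infinitesimal gauge transformation
  \<open>g\<close>. Since \<open>g\<close> vanishes on single letters, its flow is a finite sum on each word. The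
  relations between operations on \<open>U\<close> are known for homogeneous arguments, hence the restriction
  on the words whose square is required to vanish.
\<close>

locale gauge = graded_vector_space scale U
  for scale :: "'k::field_char_0 \<Rightarrow> 'u::ab_group_add \<Rightarrow> 'u" (infixr \<open>*s\<close> 75)
    and U :: "int \<Rightarrow> 'u set" +
  fixes m g :: "'u word \<Rightarrow> 'u"
  assumes m_linear: "slot_linear m" and g_linear: "slot_linear g"
    and m_graded: "graded_cochain (-1) m" and g_graded: "graded_cochain 0 g"
    and m_shuffle: "shuffle_free m" and g_shuffle: "shuffle_free g"
    and m_Nil: "m [] = 0" and g_short: "length ws \<le> 1 \<Longrightarrow> g ws = 0"
    and m_square: "hom_word ws \<Longrightarrow> coderiv (-1) m m ws = 0"
begin

text \<open>
  The Taylor coefficients of the flow of \<open>m\<close> under bracketing with \<open>g\<close>: \<open>orbit k\<close> is \<open>1 / k!\<close>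
  times the \<open>k\<close>-fold bracket \<open>[\<dots>[m, g], \<dots>, g]\<close>. The factor is distributed over the steps to
  avoid binomial coefficients later.
\<close>

fun orbit :: "nat \<Rightarrow> 'u word \<Rightarrow> 'u" where
  "orbit 0 ws = m ws"
| "orbit (Suc k) ws = (1 / of_nat (Suc k)) *s
    (coderiv 0 g (orbit k) ws - coderiv (-1) (orbit k) g ws)"

declare orbit.simps(2) [simp del]

lemma orbit_Suc_fun: "orbit (Suc k) = (\<lambda>ws. (1 / of_nat (Suc k)) *s
    (coderiv 0 g (orbit k) ws - coderiv (-1) (orbit k) g ws))"
  by (rule ext) (rule orbit.simps)

lemma orbit_0_fun: "orbit 0 = m"
  by (rule ext) simp

lemma orbit_linear: "slot_linear (orbit k)"
  by (induction k)
    (simp_all add: orbit_0_fun orbit_Suc_fun m_linear slot_linear_scale slot_linear_diff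
      slot_linear_coderiv g_linear)

lemma orbit_graded: "graded_cochain (-1) (orbit k)"
proof (induction k)
  case (Suc k)
  show ?case
    using graded_cochain_coderiv[OF g_graded Suc] graded_cochain_coderiv[OF Suc g_graded]
    by (simp add: orbit_Suc_fun graded_cochain_scale graded_cochain_diff)
qed (simp add: orbit_0_fun m_graded)

lemma orbit_shuffle: "shuffle_free (orbit k)"
proof (induction k)
  case (Suc k)
  show ?case unfolding orbit_Suc_fun
    by (intro shuffle_free_scale shuffle_free_diff shuffle_free_coderiv g_linear g_shuffle
        orbit_linear slot_linear_additive Suc)
qed (simp add: orbit_0_fun m_shuffle)

text \<open>
  Each bracket with \<open>g\<close> raises arity by at least one; hence the exponential series is finite on
  every word.
\<close>

lemma orbit_short: "length ws \<le> k \<Longrightarrow> orbit k ws = 0"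
proof (induction k arbitrary: ws)
  case (Suc k)
  have "coderiv 0 g (orbit k) ws = 0"
  proof (rule coderiv_eq_0)
    fix a u b assume s: "ws = a @ u @ b" "u \<noteq> []"
    show "orbit k (a @ out 0 g u # b) = 0"
    proof (cases "length u \<le> 1")
      case True
      then show ?thesis using slot_linear_zero[OF orbit_linear g_short] by simp
    next
      case False
      then show ?thesis using s Suc.prems by (intro Suc.IH) simp
    qed
  qed
  moreover have "coderiv (-1) (orbit k) g ws = 0"
  proof (rule coderiv_eq_0)
    fix a u b assume s: "ws = a @ u @ b" "u \<noteq> []"
    show "g (a @ out (-1) (orbit k) u # b) = 0"
    proof (cases "length u \<le> k")
      case True
      then show ?thesis using slot_linear_zero[OF g_linear Suc.IH] by simp
    next
      case False
      then have "length a + length b = 0"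
        using arg_cong[OF s(1), of length] Suc.prems unfolding length_append by linarith
      then show ?thesis by (intro g_short) simp
    qed
  qed
  ultimately show ?case by (simp add: orbit.simps(2))
qed (simp add: m_Nil)

definition orbit_comp :: "nat \<Rightarrow> nat \<Rightarrow> 'u word \<Rightarrow> 'u" where
  "orbit_comp k l ws = coderiv (-1) (orbit l) (orbit k) ws"

text \<open>
  The pre-Lie identity for \<open>orbit k\<close>, \<open>orbit l\<close> and \<open>g\<close>, solved for the bracket inside.
\<close>

lemma orbit_comp_bracket_right:
  "of_nat (Suc l) *s orbit_comp k (Suc l) ws
    = coderiv 0 g (orbit_comp k l) ws - coderiv (-1) (orbit l) (coderiv 0 g (orbit k)) ws"
proof -
  have "of_nat (Suc l) *s orbit_comp k (Suc l) ws
      = coderiv (-1) (coderiv 0 g (orbit l)) (orbit k) ws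
        - coderiv (-1) (coderiv (-1) (orbit l) g) (orbit k) ws"
    unfolding orbit_comp_def orbit_Suc_fun coderiv_op_scale[OF orbit_linear] coderiv_op_diff[OF orbit_linear]
    by (simp del: of_nat_Suc)
  also have "\<dots> = coderiv 0 g (orbit_comp k l) ws - coderiv (-1) (orbit l) (coderiv 0 g (orbit k)) ws"
  proof -
    have "orbit_comp k l = coderiv (-1) (orbit l) (orbit k)" by (rule ext) (rule orbit_comp_def)
    then have "coderiv 0 g (orbit_comp k l) ws - coderiv (-1) (coderiv 0 g (orbit l)) (orbit k) ws
      = coderiv (-1) (orbit l) (coderiv 0 g (orbit k)) ws
        - coderiv (-1) (coderiv (-1) (orbit l) g) (orbit k) ws"
      using coderiv_pre_Lie[OF slot_linear_additive[OF orbit_linear], of 0 g "-1" "orbit l" k ws]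
      by simp
    then have "coderiv 0 g (orbit_comp k l) ws = coderiv (-1) (orbit l) (coderiv 0 g (orbit k)) ws
        - coderiv (-1) (coderiv (-1) (orbit l) g) (orbit k) ws
        + coderiv (-1) (coderiv 0 g (orbit l)) (orbit k) ws"
      by (simp only: diff_eq_eq)
    then show ?thesis by simp
  qed
  finally show ?thesis .
qed

lemma orbit_comp_bracket_left:
  "of_nat (Suc k) *s orbit_comp (Suc k) l ws
    = coderiv (-1) (orbit l) (coderiv 0 g (orbit k)) ws
      - coderiv (-1) (orbit l) (coderiv (-1) (orbit k) g) ws"
  unfolding orbit_comp_def orbit_Suc_fun coderiv_scale coderiv_diff by (simp del: of_nat_Suc)

text \<open>
  The associators \<open>(g \<circ> x) \<circ> y - g \<circ> (x \<circ> y)\<close> of odd \<open>x\<close> and \<open>y\<close> are antisymmetric, so they cancel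
  in a sum that is symmetric in \<open>x\<close> and \<open>y\<close>.
\<close>

lemma sum_bracket_g:
  "(\<Sum>k\<le>n. coderiv (-1) (orbit (n - k)) (coderiv (-1) (orbit k) g) ws)
    = coderiv (-2) (\<lambda>u. \<Sum>k\<le>n. orbit_comp k (n - k) u) g ws"
proof -
  define t where "t k l = coderiv (-1) (orbit l) (coderiv (-1) (orbit k) g) ws
    - coderiv (-2) (orbit_comp k l) g ws" for k l
  have anti: "t k l = - t l k" for k l
  proof -
    have c: "orbit_comp k l = coderiv (-1) (orbit l) (orbit k)" for k l by (rule ext) (rule orbit_comp_def)
    show ?thesis
      using coderiv_pre_Lie[OF slot_linear_additive[OF g_linear], of "-1" "orbit l" "-1" "orbit k" ws]
      by (simp add: t_def c signed_def)
  qed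
  have "(\<Sum>k\<le>n. t k (n - k)) = (\<Sum>k\<le>n. t (n - k) k)"
    by (rule sum.reindex_bij_witness[of _ "\<lambda>k. n - k" "\<lambda>k. n - k"]) auto
  also have "\<dots> = - (\<Sum>k\<le>n. t k (n - k))"
    unfolding sum_negf[symmetric] by (rule sum.cong[OF refl]) (rule anti)
  finally have "2 *s (\<Sum>k\<le>n. t k (n - k)) = 0"
    using scale_left_distrib[of 1 1 "\<Sum>k\<le>n. t k (n - k)"] by (simp add: eq_neg_iff_add_eq_0)
  then have "(\<Sum>k\<le>n. t k (n - k)) = 0" by simp
  then show ?thesis by (simp add: t_def sum_subtractf coderiv_op_sum[OF g_linear])
qed

text \<open>
  The coefficients \<open>c\<^sub>n\<close> of the square of the flow satisfy the differential equation of the flow,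
  \<open>(n + 1) c\<^sub>n\<^sub>+\<^sub>1 = [c\<^sub>n, g]\<close>. The left-hand side is split by \<open>n + 1 = (n + 1 - k) + k\<close>, so
  that each part absorbs the denominator of one factor.
\<close>

lemma sum_orbit_comp_Suc:
  "of_nat (Suc n) *s (\<Sum>k\<le>Suc n. orbit_comp k (Suc n - k) ws)
    = coderiv 0 g (\<lambda>v. \<Sum>k\<le>n. orbit_comp k (n - k) v) ws
      - coderiv (-2) (\<lambda>u. \<Sum>k\<le>n. orbit_comp k (n - k) u) g ws"
proof -
  have "of_nat (Suc n) *s (\<Sum>k\<le>Suc n. orbit_comp k (Suc n - k) ws)
      = (\<Sum>k\<le>Suc n. of_nat (Suc n - k) *s orbit_comp k (Suc n - k) ws)
        + (\<Sum>k\<le>Suc n. of_nat k *s orbit_comp k (Suc n - k) ws)"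
    unfolding sum.distrib[symmetric] scale_sum_right scale_left_distrib[symmetric] of_nat_add[symmetric]
    by (rule sum.cong[OF refl]) simp
  also have "(\<Sum>k\<le>Suc n. of_nat (Suc n - k) *s orbit_comp k (Suc n - k) ws)
      = (\<Sum>k\<le>n. of_nat (Suc (n - k)) *s orbit_comp k (Suc (n - k)) ws)"
    unfolding sum.atMost_Suc diff_self_eq_0
    by (auto intro!: sum.cong simp: Suc_diff_le simp del: of_nat_Suc of_nat_diff)
  also have "(\<Sum>k\<le>Suc n. of_nat k *s orbit_comp k (Suc n - k) ws)
      = (\<Sum>k\<le>n. of_nat (Suc k) *s orbit_comp (Suc k) (n - k) ws)"
    by (subst sum.atMost_Suc_shift) simp
  finally show ?thesis
    unfolding orbit_comp_bracket_left orbit_comp_bracket_right sum_subtractf sum_bracket_g coderiv_sum by simp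
qed

lemma sum_orbit_comp_eq_0: "hom_word ws \<Longrightarrow> (\<Sum>k\<le>n. orbit_comp k (n - k) ws) = 0"
proof (induction n arbitrary: ws)
  case 0
  then show ?case using m_square by (simp add: orbit_comp_def orbit_0_fun)
next
  case (Suc n)
  let ?c = "\<lambda>v. \<Sum>k\<le>n. orbit_comp k (n - k) v"
  have "coderiv 0 g ?c ws = 0"
    by (rule coderiv_eq_0, rule Suc.IH) (use Suc.prems hom_word_out[OF g_graded] in auto)
  moreover have "coderiv (-2) ?c g ws = 0"
    by (rule coderiv_eq_0, rule slot_linear_zero[OF g_linear], rule Suc.IH) (use Suc.prems in auto)
  ultimately have "of_nat (Suc n) *s (\<Sum>k\<le>Suc n. orbit_comp k (Suc n - k) ws) = 0"
    unfolding sum_orbit_comp_Suc by simp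
  then show ?case by (simp del: of_nat_Suc sum.atMost_Suc)
qed

text \<open>
  The flow at time one. The bound is where the series stops on a word of the given length.
\<close>

definition transform :: "'u word \<Rightarrow> 'u" where
  "transform ws = (\<Sum>k<length ws. orbit k ws)"

lemma transform_eq: "length ws \<le> N \<Longrightarrow> transform ws = (\<Sum>k<N. orbit k ws)"
  unfolding transform_def by (rule sum.mono_neutral_left) (auto simp: orbit_short)

lemma transform_linear: "slot_linear transform"
  unfolding slot_linear_def transform_def
  by (auto intro!: lin_intros slot_linearD[OF orbit_linear])

lemma transform_graded: "graded_cochain (-1) transform"
  using orbit_graded unfolding graded_cochain_def transform_def
  by (auto intro!: subspace_sum[OF subspace_component])

lemma transform_shuffle: "shuffle_free transform"
  unfolding shuffle_free_def
proof (intro allI impI)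
  fix xs ys :: "'u word" assume ne: "xs \<noteq> []" "ys \<noteq> []"
  let ?N = "length xs + length ys"
  have "shuffle transform xs ys = shuffle (\<lambda>v. \<Sum>k<?N. orbit k v) xs ys"
    by (rule length_shuffle_cong) (simp add: transform_def)
  also have "\<dots> = (\<Sum>k<?N. shuffle (orbit k) xs ys)"
  proof -
    have "shuffle (\<lambda>v. \<Sum>k\<in>I. orbit k v) xs ys = (\<Sum>k\<in>I. shuffle (orbit k) xs ys)"
      if "finite I" for I :: "nat set"
      using that by induction (simp_all add: shuffle_add)
    then show ?thesis by simp
  qed
  also have "\<dots> = 0"
    using orbit_shuffle ne by (simp add: shuffle_free_def)
  finally show "shuffle transform xs ys = 0" .
qed

text \<open>
  On a fixed word the series may be cut off at the length of the word in both arguments; the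
  products that remain are grouped by total order, and each group is a coefficient of the square
  of the flow.
\<close>

theorem transform_square:
  assumes "hom_word ws"
  shows "coderiv (-1) transform transform ws = 0"
proof -
  let ?N = "length ws"
  have "coderiv (-1) transform transform ws
      = coderiv (-1) (\<lambda>u. \<Sum>l<?N. orbit l u) (\<lambda>v. \<Sum>k<?N. orbit k v) ws"
  proof (rule coderiv_cong)
    fix a u b assume s: "ws = a @ u @ b" "u \<noteq> []"
    then have "out (-1) (\<lambda>u. \<Sum>l<?N. orbit l u) u = out (-1) transform u"
      by (simp add: out_def transform_eq[of u ?N])
    moreover have "transform (a @ out (-1) transform u # b)
        = (\<Sum>k<?N. orbit k (a @ out (-1) transform u # b))"
      using s by (intro transform_eq) (cases u, auto)
    ultimately show "transform (a @ out (-1) transform u # b)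
        = (\<Sum>k<?N. orbit k (a @ out (-1) (\<lambda>u. \<Sum>l<?N. orbit l u) u # b))" by simp
  qed simp
  also have "\<dots> = (\<Sum>k<?N. \<Sum>l<?N. orbit_comp k l ws)"
    by (simp add: coderiv_sum coderiv_op_sum[OF orbit_linear] orbit_comp_def)
  also have "\<dots> = (\<Sum>(k, l) \<in> {..<?N} \<times> {..<?N}. orbit_comp k l ws)"
    by (rule sum.cartesian_product)
  also have "\<dots> = (\<Sum>(k, l) \<in> {(k, l). k + l < ?N}. orbit_comp k l ws)"
  proof (rule sum.mono_neutral_right)
    have zero: "orbit_comp k l ws = 0" if "?N \<le> k + l" for k l
      unfolding orbit_comp_def
    proof (rule coderiv_eq_0)
      fix a u b assume s: "ws = a @ u @ b" "u \<noteq> []"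
      show "orbit k (a @ out (-1) (orbit l) u # b) = 0"
      proof (cases "length u \<le> l")
        case True
        then show ?thesis using slot_linear_zero[OF orbit_linear orbit_short] by simp
      next
        case False
        then show ?thesis using s that by (intro orbit_short) simp
      qed
    qed
    show "\<forall>i\<in>{..<?N} \<times> {..<?N} - {(k, l). k + l < ?N}. (case i of (k, l) \<Rightarrow> orbit_comp k l ws) = 0"
      by (auto intro!: zero)
  qed auto
  also have "\<dots> = (\<Sum>n<?N. \<Sum>k\<le>n. orbit_comp k (n - k) ws)"
    by (rule sum.triangle_reindex)
  also have "\<dots> = 0"
    using sum_orbit_comp_eq_0[OF assms] by simp
  finally show ?thesis .
qed

lemma transform_single: "transform [w] = m [w]"
  by (simp add: transform_def)

lemma transform_pair: "transform [v, w] = m [v, w] + (coderiv 0 g m [v, w] - coderiv (-1) m g [v, w])"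
proof -
  have "{..<length [v, w]} = {0, 1}" by auto
  then show ?thesis by (simp add: transform_def orbit.simps(2)[of 0, simplified] orbit_0_fun)
qed

end

section \<open>Multilinear operations from cochains on words\<close>

context graded_vector_space
begin

definition component :: "'u \<Rightarrow> int \<Rightarrow> 'u" where
  "component x = (THE c. (\<forall>p. c p \<in> U p) \<and> finite {p. c p \<noteq> 0} \<and> (\<Sum>p | c p \<noteq> 0. c p) = x)"

lemma component:
  "component x p \<in> U p" "finite {p. component x p \<noteq> 0}"
  "(\<Sum>p | component x p \<noteq> 0. component x p) = x"
  using theI'[OF direct_sum[of x], folded component_def] by auto

lemma component_unique:
  assumes "\<And>p. c p \<in> U p" "finite S" "\<And>p. p \<notin> S \<Longrightarrow> c p = 0" "(\<Sum>p\<in>S. c p) = x"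
  shows "component x = c"
proof -
  have sub: "{p. c p \<noteq> 0} \<subseteq> S" using assms(3) by auto
  have "(\<Sum>p | c p \<noteq> 0. c p) = x"
    using sum.mono_neutral_left[OF assms(2) sub, of c] assms(4) by simp
  moreover have "finite {p. c p \<noteq> 0}" using sub assms(2) by (rule finite_subset)
  ultimately have "(\<forall>p. c p \<in> U p) \<and> finite {p. c p \<noteq> 0} \<and> (\<Sum>p | c p \<noteq> 0. c p) = x"
    using assms(1) by blast
  moreover have "(\<forall>p. component x p \<in> U p) \<and> finite {p. component x p \<noteq> 0} \<and>
      (\<Sum>p | component x p \<noteq> 0. component x p) = x"
    using component by blast
  ultimately show ?thesis using direct_sum[of x] by blast
qed

lemma component_of_mem: "x \<in> U p \<Longrightarrow> component x = (\<lambda>q. if q = p then x else 0)"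
  by (rule component_unique[of _ "{p}"]) (auto simp: subspace_0[OF subspace_component])

lemma sum_component:
  assumes "finite S" "{p. component x p \<noteq> 0} \<subseteq> S" "\<And>p. F p 0 = 0"
  shows "(\<Sum>p | component x p \<noteq> 0. F p (component x p)) = (\<Sum>p\<in>S. F p (component x p))"
  by (rule sum.mono_neutral_left) (use assms in auto)

lemma lin_component: "lin (\<lambda>x. component x p)"
proof -
  have "component (x + y) = (\<lambda>p. component x p + component y p)" for x y
  proof (rule component_unique)
    let ?S = "{p. component x p \<noteq> 0} \<union> {p. component y p \<noteq> 0}"
    show "finite ?S" using component(2) by simp
    show "(\<Sum>p\<in>?S. component x p + component y p) = x + y"
      using sum_component[of ?S x "\<lambda>p x. x"] sum_component[of ?S y "\<lambda>p x. x"] component(2,3)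
      by (simp add: sum.distrib)
  qed (auto simp: component subspace_add[OF subspace_component])
  moreover have "component (c *s x) = (\<lambda>p. c *s component x p)" for c x
    by (rule component_unique[of _ "{p. component x p \<noteq> 0}"])
      (auto simp: component subspace_scale[OF subspace_component] simp flip: scale_sum_right)
  ultimately show ?thesis by (simp add: lin_iff)
qed

text \<open>
  The supports of two vectors and of their sum may differ, so all three sums are taken over the
  union of the two supports.
\<close>

lemma lin_sum_component:
  assumes "\<And>p. lin (F p)"
  shows "lin (\<lambda>x. \<Sum>p | component x p \<noteq> 0. F p (component x p))" (is "lin ?G")
proof -
  have F0: "F p 0 = 0" for p by (rule linD(3)[OF assms])
  have 1: "?G (x + y) = ?G x + ?G y" for x y
  proof -
    let ?S = "{p. component x p \<noteq> 0} \<union> {p. component y p \<noteq> 0}"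
    have f: "finite ?S" using component(2) by simp
    have "?G (x + y) = (\<Sum>p\<in>?S. F p (component (x + y) p))"
      by (rule sum_component[where F = F, OF f _ F0]) (auto simp: linD(1)[OF lin_component])
    moreover have "?G x = (\<Sum>p\<in>?S. F p (component x p))" "?G y = (\<Sum>p\<in>?S. F p (component y p))"
      by (rule sum_component[where F = F, OF f _ F0]; auto)+
    ultimately show ?thesis
      by (simp add: linD(1)[OF lin_component] linD(1)[OF assms] sum.distrib)
  qed
  have 2: "?G (c *s x) = c *s ?G x" for c x
  proof -
    have "?G (c *s x) = (\<Sum>p | component x p \<noteq> 0. F p (component (c *s x) p))"
      by (rule sum_component[where F = F, OF component(2) _ F0]) (auto simp: linD(2)[OF lin_component])
    then show ?thesis
      by (simp add: linD(2)[OF lin_component] linD(2)[OF assms] scale_sum_right)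
  qed
  show ?thesis unfolding lin_iff using 1 2 by blast
qed

text \<open>
  A functional on words is defined on homogeneous letters with their degrees; multilinear maps on
  \<open>U\<close> arise by expanding every argument into its components.
\<close>

fun multilinear_extension :: "('u word \<Rightarrow> 'u) \<Rightarrow> 'u list \<Rightarrow> 'u" where
  "multilinear_extension \<phi> [] = \<phi> []"
| "multilinear_extension \<phi> (w # ws) = (\<Sum>p | component w p \<noteq> 0.
      multilinear_extension (\<lambda>v. \<phi> ((p + 1, component w p) # v)) ws)"

text \<open>
  Adding one to the degrees is the suspension.
\<close>

definition tag :: "int list \<Rightarrow> 'u list \<Rightarrow> 'u word" where
  "tag ps ws = zip (map (\<lambda>p. p + 1) ps) ws"

lemma lin_multilinear_extension_param:
  "(\<And>v. lin (\<lambda>y. \<phi> y v)) \<Longrightarrow> lin (\<lambda>y. multilinear_extension (\<phi> y) ws)"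
proof (induction ws arbitrary: \<phi>)
  case (Cons w ws)
  show ?case unfolding multilinear_extension.simps by (intro lin_intros Cons)
qed simp

lemma lin_multilinear_extension:
  "slot_linear \<phi> \<Longrightarrow> k < length ws \<Longrightarrow> lin (\<lambda>x. multilinear_extension \<phi> (ws[k := x]))"
proof (induction ws arbitrary: \<phi> k)
  case (Cons w ws)
  show ?case
  proof (cases k)
    case 0
    show ?thesis unfolding 0 list_update.simps nat.case multilinear_extension.simps
      by (intro lin_sum_component lin_multilinear_extension_param slot_linear_hd Cons.prems(1))
  next
    case (Suc j)
    then have j: "j < length ws" using Cons.prems(2) by simp
    show ?thesis unfolding Suc list_update.simps nat.case multilinear_extension.simps
      by (intro lin_intros Cons.IH slot_linear_Cons Cons.prems(1) j)
  qed
qed simp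

lemma multilinear_multilinear_extension:
  "slot_linear \<phi> \<Longrightarrow> multilinear m (multilinear_extension \<phi>)"
  using lin_multilinear_extension by (simp add: multilinear_def)

lemma multilinear_extension_homogeneous:
  "slot_linear \<phi> \<Longrightarrow> homogeneous ps ws \<Longrightarrow> multilinear_extension \<phi> ws = \<phi> (tag ps ws)"
proof (induction ws arbitrary: \<phi> ps)
  case Nil
  then show ?case by (simp add: homogeneous_def tag_def)
next
  case (Cons w ws)
  obtain p ps' where ps: "ps = p # ps'" and w: "w \<in> U p" and h: "homogeneous ps' ws"
    using Cons.prems(2) unfolding homogeneous_def by (cases ps) auto
  have "multilinear_extension \<phi> (w # ws)
      = (\<Sum>q | component w q \<noteq> 0. (\<lambda>q y. \<phi> ((q + 1, y) # tag ps' ws)) q (component w q))"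
    using Cons.IH[OF slot_linear_Cons[OF Cons.prems(1)] h] by simp
  also have "\<dots> = (\<Sum>q\<in>{p}. (\<lambda>q y. \<phi> ((q + 1, y) # tag ps' ws)) q (component w q))"
    by (rule sum_component)
      (auto simp: component_of_mem[OF w] linD(3)[OF slot_linear_hd[OF Cons.prems(1)]] split: if_splits)
  finally show ?case by (simp add: ps tag_def component_of_mem[OF w])
qed

lemma hom_word_tag: "homogeneous ps ws \<Longrightarrow> hom_word (tag ps ws)"
  unfolding homogeneous_def tag_def
  by (induction rule: list_all2_induct) auto

lemma length_homogeneous: "homogeneous ps ws \<Longrightarrow> length ps = length ws"
  by (simp add: homogeneous_def list_all2_lengthD)

lemma deg_tag: "length ps = length ws \<Longrightarrow> deg (tag ps ws) = sum_list ps + int (length ws)"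
  unfolding tag_def by (induction ps ws rule: list_induct2) auto

lemma map_fst_tag: "length ps = length ws \<Longrightarrow> map fst (tag ps ws) = map (\<lambda>p. p + 1) ps"
  by (simp add: tag_def)

lemma length_tag: "length ps = length ws \<Longrightarrow> length (tag ps ws) = length ws"
  by (simp add: tag_def)

end

lemma deconcat_sum: "deconcat \<psi> ws = (\<Sum>k\<le>length ws. \<psi> (take k ws) (drop k ws))"
proof (induction ws arbitrary: \<psi>)
  case (Cons w ws)
  show ?case unfolding deconcat.simps Cons.IH length_Cons by (subst sum.atMost_Suc_shift) simp
qed simp

lemma coderiv_sum_insertions:
  "coderiv e f \<phi> ws = (\<Sum>s<length ws. \<Sum>j<length ws - s. signed (e * deg (take s ws))
      (\<phi> (take s ws @ out e f (take (Suc j) (drop s ws)) # drop (s + Suc j) ws)))"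
proof (induction ws arbitrary: \<phi>)
  case (Cons w ws)
  have "(\<Sum>s<length (w # ws). \<Sum>j<length (w # ws) - s. signed (e * deg (take s (w # ws)))
      (\<phi> (take s (w # ws) @ out e f (take (Suc j) (drop s (w # ws))) # drop (s + Suc j) (w # ws))))
    = (\<Sum>j<Suc (length ws). \<phi> (out e f (w # take j ws) # drop j ws))
    + signed (e * fst w) (\<Sum>s<length ws. \<Sum>j<length ws - s. signed (e * deg (take s ws))
        (\<phi> (w # take s ws @ out e f (take (Suc j) (drop s ws)) # drop (s + Suc j) ws)))"
    unfolding length_Cons sum.lessThan_Suc_shift signed_sum
    by (simp add: distrib_left sum.lessThan_Suc_shift del: sum.lessThan_Suc)
  then show ?case
    unfolding coderiv.simps Cons.IH deconcat_sum by (simp add: lessThan_Suc_atMost)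
qed simp

text \<open>
  The exponent of the decalage sign: each letter is moved past the suspensions of the letters that
  follow it. The summand \<open>triangle\<close> below depends on the arity only; it accounts for the part of
  the signs of the \<open>A(\<infinity>)\<close>-relations that depends on the arities of the two operations alone.
\<close>

fun susp_exp :: "'u word \<Rightarrow> int" where
  "susp_exp [] = 0"
| "susp_exp (z # zs) = int (length zs) * (fst z - 1) + susp_exp zs"

lemma susp_exp_append:
  "susp_exp (a @ b) = susp_exp a + int (length b) * (deg a - int (length a)) + susp_exp b"
  by (induction a) (auto simp: algebra_simps)

definition triangle :: "nat \<Rightarrow> int" where
  "triangle k = int (\<Sum>{..<k})"

text \<open>
  This rule is what makes the arity-dependent signs of \<open>n\<^sub>i\<close> and \<open>n\<^sub>j\<close> combine to that of
  \<open>n\<^sub>i\<^sub>+\<^sub>j\<^sub>-\<^sub>1\<close> up to \<open>(i - 1) (j - 1)\<close>.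
\<close>

lemma triangle_add: "triangle (a + b) = triangle a + triangle b + int (a * b)"
  by (induction b) (auto simp: triangle_def algebra_simps)

lemma triangle_simps [simp]: "triangle 0 = 0" "triangle (Suc 0) = 0"
  by (simp_all add: triangle_def)

context graded_vector_space
begin

lemma powi_scale: "(-1) powi q *s x = signed q x"
  by (auto simp: signed_def)

definition desuspend :: "('u word \<Rightarrow> 'u) \<Rightarrow> nat \<Rightarrow> 'u list \<Rightarrow> 'u" where
  "desuspend b i = multilinear_extension (\<lambda>zs. signed (susp_exp zs + triangle (i - 1)) (b zs))"

lemma susp_exp_cong: "map fst a = map fst b \<Longrightarrow> susp_exp a = susp_exp b"
proof (induction a arbitrary: b)
  case (Cons z a)
  then show ?case by (cases b) (auto dest: map_eq_imp_length_eq)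
qed simp

lemma slot_linear_signed:
  assumes b: "slot_linear b"
  shows "slot_linear (\<lambda>zs. signed (susp_exp zs + r) (b zs))"
  unfolding slot_linear_def
proof (intro allI)
  fix a c :: "'u word" and q
  define E where "E = susp_exp (a @ (q, 0) # c)"
  have "susp_exp (a @ (q, x) # c) = E" for x
    unfolding E_def by (rule susp_exp_cong) simp
  then show "lin (\<lambda>x. signed (susp_exp (a @ (q, x) # c) + r) (b (a @ (q, x) # c)))"
    using lin_intros(6)[OF slot_linearD[OF b, of a q c]] by simp
qed

lemma desuspend_homogeneous:
  assumes "slot_linear b" "homogeneous ps ws"
  shows "desuspend b i ws = signed (susp_exp (tag ps ws) + triangle (i - 1)) (b (tag ps ws))"
  unfolding desuspend_def
  by (rule multilinear_extension_homogeneous[OF slot_linear_signed[OF assms(1)] assms(2)])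

lemma graded_multilinear_desuspend:
  assumes "slot_linear b" "graded_cochain (-1) b" "0 < i"
  shows "graded_multilinear i (int i - 2) (desuspend b i)"
  unfolding graded_multilinear_def
proof (intro conjI allI impI)
  show "multilinear i (desuspend b i)"
    unfolding desuspend_def by (rule multilinear_multilinear_extension[OF slot_linear_signed[OF assms(1)]])
  fix ps ws assume l: "length ws = i" and h: "homogeneous ps ws"
  have lp: "length ps = length ws" by (rule length_homogeneous[OF h])
  have "tag ps ws \<noteq> []" using l lp assms(3) length_tag[of ps ws] by fastforce
  then have "b (tag ps ws) \<in> U (deg (tag ps ws) + - 1 - 1)"
    using assms(2) hom_word_tag[OF h] unfolding graded_cochain_def by blast
  then show "desuspend b i ws \<in> U (sum_list ps + (int i - 2))"
    using l lp by (simp add: desuspend_homogeneous[OF assms(1) h] deg_tag algebra_simps)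
qed

text \<open>
  One insertion of \<open>b\<close> into itself, expressed through the operations of \<open>U\<close>. The exponents
  \<open>susp_exp zs\<close> and \<open>triangle (length ws - 1)\<close> are the same for all insertions; what remains is,
  up to an overall sign, the sign of the \<open>A(\<infinity>)\<close>-relations.
\<close>

lemma desuspend_insertion:
  assumes b: "slot_linear b" "graded_cochain (-1) b" and h: "homogeneous ps ws"
    and sj: "s + j \<le> length ws" and j: "1 \<le> j"
  defines "zs \<equiv> tag ps ws" and "i \<equiv> length ws + 1 - j"
  shows "signed (- deg (take s zs)) (b (take s zs @ out (-1) b (take j (drop s zs)) # drop (s + j) zs))
    = signed (susp_exp zs + triangle (length ws - 1)
        + int j * sum_list (take s ps) + int s * (int j + 1) + int (length ws) - int j)
       (desuspend b i (take s ws @ [desuspend b j (take j (drop s ws))] @ drop (s + j) ws))"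
proof -
  have lp: "length ps = length ws" by (rule length_homogeneous[OF h])
  let ?A = "take s zs" and ?B = "take j (drop s zs)" and ?C = "drop (s + j) zs"
  let ?y = "desuspend b j (take j (drop s ws))"
  let ?r = "sum_list (take j (drop s ps)) + int j - 2"
  have hA: "homogeneous (take s ps) (take s ws)" and hB: "homogeneous (take j (drop s ps)) (take j (drop s ws))"
    and hC: "homogeneous (drop (s + j) ps) (drop (s + j) ws)"
    using h unfolding homogeneous_def by (simp_all add: list_all2_takeI list_all2_dropI)
  have tA: "tag (take s ps) (take s ws) = ?A" and tB: "tag (take j (drop s ps)) (take j (drop s ws)) = ?B"
    and tC: "tag (drop (s + j) ps) (drop (s + j) ws) = ?C"
    unfolding zs_def tag_def by (simp_all add: take_map drop_map take_zip drop_zip)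
  have lB: "length (take j (drop s ws)) = j" using sj by simp
  have "graded_multilinear j (int j - 2) (desuspend b j)"
    using graded_multilinear_desuspend[OF b] j by simp
  then have "?y \<in> U (sum_list (take j (drop s ps)) + (int j - 2))"
    using hB lB unfolding graded_multilinear_def by blast
  then have y: "?y \<in> U ?r" by (simp only: add_diff_eq)
  have h': "homogeneous (take s ps @ [?r] @ drop (s + j) ps) (take s ws @ [?y] @ drop (s + j) ws)"
    using hA hC y unfolding homogeneous_def by (auto intro!: list_all2_appendI)
  have t': "tag (take s ps @ [?r] @ drop (s + j) ps) (take s ws @ [?y] @ drop (s + j) ws)
      = ?A @ (?r + 1, ?y) # ?C"
    using tA tC lp unfolding tag_def by simp
  have dB: "deg ?B = sum_list (take j (drop s ps)) + int j"
    using deg_tag[of "take j (drop s ps)" "take j (drop s ws)"] lp sj tB by simp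
  have dA: "deg ?A = sum_list (take s ps) + int s"
    using deg_tag[of "take s ps" "take s ws"] lp sj tA by simp
  have y': "?y = signed (susp_exp ?B + triangle (j - 1)) (b ?B)"
    using desuspend_homogeneous[OF b(1) hB] tB by simp
  let ?z = "?A @ (?r + 1, ?y) # ?C"
  have D: "desuspend b i (take s ws @ [?y] @ drop (s + j) ws)
      = signed (susp_exp ?z + triangle (i - 1)) (b ?z)"
    using desuspend_homogeneous[OF b(1) h'] t' by simp
  have o: "out (-1) b ?B = (?r + 1, b ?B)" by (simp add: out_def dB)
  have bz: "b ?z = signed (susp_exp ?B + triangle (j - 1)) (b (?A @ out (-1) b ?B # ?C))"
    unfolding o y' by (rule linD(6)[OF slot_linearD[OF b(1)]])
  have lz: "length zs = length ws" using lp by (simp add: zs_def length_tag)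
  have i: "int (length ?C) = int (i - 1) - int s" "int (i - 1) = int (length ws) - int j"
    and ji: "(j - 1) + (i - 1) = length ws - 1"
    using sj j lz by (simp_all add: i_def of_nat_diff)
  have zs: "zs = ?A @ ?B @ ?C" by (metis append_take_drop_id drop_drop add.commute)
  have E: "susp_exp zs = susp_exp ?A + susp_exp ?B + susp_exp ?C
      + (int j + int (length ?C)) * (deg ?A - int s) + int (length ?C) * (deg ?B - int j)"
    by (subst zs, unfold susp_exp_append) (use lz sj in \<open>simp add: algebra_simps\<close>)
  have E': "susp_exp ?z = susp_exp ?A + susp_exp ?C
      + (1 + int (length ?C)) * (deg ?A - int s) + int (length ?C) * ?r"
    unfolding susp_exp_append using lz sj by (simp add: algebra_simps)
  have T: "triangle (length ws - 1) = triangle (j - 1) + triangle (i - 1) + int (j - 1) * int (i - 1)"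
    using triangle_add[of "j - 1" "i - 1"] unfolding ji of_nat_mult .
  have parity: "even (- deg ?A - (susp_exp zs + triangle (length ws - 1)
        + int j * sum_list (take s ps) + int s * (int j + 1) + int (length ws) - int j
        + (susp_exp ?z + triangle (i - 1)) + (susp_exp ?B + triangle (j - 1))))"
    unfolding E E' T dA dB i using j by (simp add: of_nat_diff algebra_simps)
  show ?thesis
    unfolding D bz signed_simps by (rule signed_cong) (use parity in \<open>simp add: algebra_simps\<close>)
qed

end

context graded_chain_complex
begin

text \<open>
  Blocks of full length and blocks of length one are the terms that involve the differential.
\<close>

lemma sum_insertions_by_length:
  fixes F :: "nat \<Rightarrow> nat \<Rightarrow> 'b::ab_group_add"
  assumes "2 \<le> m"
  shows "(\<Sum>s<m. \<Sum>j<m - s. F s (Suc j))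
    = F 0 m + (\<Sum>s<m. F s 1) + (\<Sum>j\<in>{2..<m}. \<Sum>s = 0..m - j. F s j)"
proof -
  have "(\<Sum>s<m. \<Sum>j<m - s. F s (Suc j)) = (\<Sum>(s, j)\<in>(SIGMA s:{..<m}. {..<m - s}). F s (Suc j))"
    by (rule sum.Sigma) auto
  also have "\<dots> = (\<Sum>(j, s)\<in>(SIGMA j:{1..m}. {0..m - j}). F s j)"
    by (rule sum.reindex_bij_witness[of _ "\<lambda>(j, s). (s, j - 1)" "\<lambda>(s, j). (Suc j, s)"]) auto
  also have "\<dots> = (\<Sum>j\<in>{1..m}. \<Sum>s = 0..m - j. F s j)"
    by (rule sum.Sigma[symmetric]) auto
  also have "{1..m} = insert 1 (insert m {2..<m})" using assms by auto
  also have "(\<Sum>j\<in>insert 1 (insert m {2..<m}). \<Sum>s = 0..m - j. F s j)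
      = (\<Sum>s = 0..m - 1. F s 1) + (F 0 m + (\<Sum>j\<in>{2..<m}. \<Sum>s = 0..m - j. F s j))"
    using assms by simp
  also have "{0..m - 1} = {..<m}" using assms by auto
  finally show ?thesis by (simp add: ac_simps)
qed

lemma power_scale: "(-1) ^ k *s x = signed (int k) x"
  by (auto simp: signed_def)

text \<open>
  The terms of \<open>b \<circ> b = 0\<close> that contain the unary component form the induced differential of the
  operation of arity \<open>m\<close>; the others are, with the opposite sign, the right-hand side of its
  \<open>A(\<infinity>)\<close>-relation.
\<close>

lemma A_infinity_desuspend:
  assumes b: "slot_linear b" "graded_cochain (-1) b"
    and square: "\<And>zs. hom_word zs \<Longrightarrow> coderiv (-1) b b zs = 0"
    and unary: "\<And>z. b [z] = d (snd z)"
  shows "A_infinity_algebra scale U d (desuspend b)"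
proof
  fix i :: nat assume "2 \<le> i"
  then show "graded_multilinear i (int i - 2) (desuspend b i)"
    by (intro graded_multilinear_desuspend b) simp
next
  fix m :: nat and ws ps
  assume m: "2 \<le> m" and l: "length ws = m" and h: "homogeneous ps ws"
  define zs where "zs = tag ps ws"
  have lz: "length zs = m" using l length_homogeneous[OF h] by (simp add: zs_def length_tag)
  define t where "t s j = desuspend b (m + 1 - j)
      (take s ws @ [desuspend b j (take j (drop s ws))] @ drop (s + j) ws)" for s j
  define F where "F s j = signed (int j * sum_list (take s ps) + int s * (int j + 1) + int m - int j)
      (t s j)" for s j
  have d1: "desuspend b 1 [x] = d x" if "x \<in> U p" for x p
    using desuspend_homogeneous[OF b(1), of "[p]" "[x]" 1] that
    by (simp add: homogeneous_def tag_def unary)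
  have "0 = coderiv (-1) b b zs"
    using square[OF hom_word_tag[OF h]] by (simp add: zs_def)
  also have "\<dots> = (\<Sum>s<m. \<Sum>j<m - s. signed (susp_exp zs + triangle (m - 1)) (F s (Suc j)))"
    unfolding coderiv_sum_insertions lz
  proof (intro sum.cong refl)
    fix s j assume "s \<in> {..<m}" "j \<in> {..<m - s}"
    then have "s + Suc j \<le> length ws" using l by auto
    from desuspend_insertion[OF b h this]
    show "signed (- 1 * deg (take s zs))
          (b (take s zs @ out (-1) b (take (Suc j) (drop s zs)) # drop (s + Suc j) zs))
        = signed (susp_exp zs + triangle (m - 1)) (F s (Suc j))"
      by (simp add: F_def t_def zs_def l add.assoc add_diff_eq)
  qed
  also have "\<dots> = signed (susp_exp zs + triangle (m - 1)) (\<Sum>s<m. \<Sum>j<m - s. F s (Suc j))"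
    by (simp add: signed_sum)
  finally have "(\<Sum>s<m. \<Sum>j<m - s. F s (Suc j)) = 0"
    by (simp add: signed_def split: if_splits)
  then have total: "F 0 m + (\<Sum>s<m. F s 1) + (\<Sum>j\<in>{2..<m}. \<Sum>s = 0..m - j. F s j) = 0"
    unfolding sum_insertions_by_length[OF m] .
  have "homogeneous [p] [desuspend b m ws]" if "p = sum_list ps + int m - 2" for p
    using graded_multilinear_desuspend[OF b, of m] m h l that
    unfolding graded_multilinear_def homogeneous_def by (simp add: add_diff_eq)
  then have "desuspend b m ws \<in> U (sum_list ps + int m - 2)" by (simp add: homogeneous_def)
  then have F0: "F 0 m = d (desuspend b m ws)"
    using d1 l by (simp add: F_def t_def)
  have F1: "F s 1 = - ((-1) powi (int m - 2) *s
      (-1) powi (sum_list (take s ps)) *s desuspend b m (ws[s := d (ws ! s)]))" if "s < m" for s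
  proof -
    have "ws ! s \<in> U (ps ! s)"
      using h that l unfolding homogeneous_def by (auto simp: list_all2_conv_all_nth)
    moreover have "take 1 (drop s ws) = [ws ! s]"
      using that l by (metis take_Suc_conv_app_nth One_nat_def drop_all Cons_nth_drop_Suc take0 take_Suc_Cons)
    ultimately have "t s 1 = desuspend b m (ws[s := d (ws ! s)])"
      using d1 that l by (simp add: t_def upd_conv_take_nth_drop)
    then show ?thesis
      unfolding F_def powi_scale by (auto simp: signed_def)
  qed
  have F2: "F s j = - ((-1) ^ (m + 1 - j + s * (j + 1)) *s
      insertion s j (int j - 2) (desuspend b (m + 1 - j)) (desuspend b j) ps ws)"
    if "j \<in> {2..<m}" for s j
  proof -
    have e: "even (int j * S + int s * (int j + 1) + int m - int j
        - (int (m + 1 - j + s * (j + 1)) + (int j - 2) * S) - 1)" for S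
      using that by (simp add: of_nat_diff algebra_simps)
    have "- signed q x = signed (q + 1) x" for q and x :: 'u by (simp add: signed_def)
    then show ?thesis
      unfolding F_def t_def insertion_def powi_scale power_scale signed_simps
      by (simp only:) (rule signed_cong, use e in \<open>simp add: algebra_simps\<close>)
  qed
  have "hom_differential (int m - 2) (desuspend b m) ps ws = F 0 m + (\<Sum>s<m. F s 1)"
    unfolding hom_differential_def F0 using F1 by (simp add: l scale_sum_right sum_negf)
  also have "\<dots> = - (\<Sum>j\<in>{2..<m}. \<Sum>s = 0..m - j. F s j)"
    using total by (simp add: eq_neg_iff_add_eq_0)
  also have "\<dots> = (\<Sum>j\<in>{2..<m}. \<Sum>s = 0..m - j. (-1) ^ (m + 1 - j + s * (j + 1)) *s
      insertion s j (int j - 2) (desuspend b (m + 1 - j)) (desuspend b j) ps ws)"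
    unfolding sum_negf[symmetric] by (intro sum.cong refl) (simp add: F2)
  also have "\<dots> = (\<Sum>(i, j) \<in> {(i, j). i + j = m + 1 \<and> 2 \<le> i \<and> 2 \<le> j}. \<Sum>s = 0..m - j.
      (-1) ^ (i + s * (j + 1)) *s insertion s j (int j - 2) (desuspend b i) (desuspend b j) ps ws)"
    by (rule sum.reindex_bij_witness[of _ snd "\<lambda>j. (m + 1 - j, j)"]) auto
  finally show "hom_differential (int m - 2) (desuspend b m) ps ws
      = (\<Sum>(i, j) \<in> {(i, j). i + j = m + 1 \<and> 2 \<le> i \<and> 2 \<le> j}. \<Sum>s = 0..m - j.
      (-1) ^ (i + s * (j + 1)) *s insertion s j (int j - 2) (desuspend b i) (desuspend b j) ps ws)" .
qed

end

section \<open>Shuffle permutations\<close>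

text \<open>
  The shuffle product can also be computed by its last letter. Splitting shuffle permutations at
  the last position, unlike the first, needs no renumbering of the positions in front.
\<close>

lemma shuffle_snoc:
  "shuffle \<phi> (xs @ [x]) (ys @ [y]) = shuffle (\<lambda>v. \<phi> (v @ [y])) (xs @ [x]) ys
    + signed (fst x * deg (ys @ [y])) (shuffle (\<lambda>v. \<phi> (v @ [x])) xs (ys @ [y]))"
proof (induction xs arbitrary: \<phi> ys)
  case outer: Nil
  show ?case
    by (induction ys arbitrary: \<phi>) (simp_all add: signed_add algebra_simps)
next
  case outer: (Cons x' xs)
  show ?case
  proof (induction ys arbitrary: \<phi>)
    case Nil
    show ?case using outer.IH[of _ "[]"] by (simp add: signed_add algebra_simps)
  next
    case (Cons y' ys)
    show ?case using outer.IH[of _ "y' # ys"] Cons.IH by (simp add: signed_add algebra_simps)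
  qed
qed

text \<open>
  A cycle on the positions \<open>a, \<dots>, a + n\<close>.
\<close>

definition cycle_up :: "nat \<Rightarrow> nat \<Rightarrow> nat \<Rightarrow> nat" where
  "cycle_up a n k = (if k = a then a + n else if a < k \<and> k \<le> a + n then k - 1 else k)"

lemma cycle_up_0: "cycle_up a 0 = id"
  by (auto simp: cycle_up_def)

lemma cycle_up_Suc: "cycle_up a (Suc n) = transpose (a + n) (a + Suc n) \<circ> cycle_up a n"
  by (auto simp: cycle_up_def transpose_def fun_eq_iff)

lemma cycle_up_permutes: "a + n < N \<Longrightarrow> cycle_up a n permutes {..<N}"
  by (induction n) (auto simp: cycle_up_0 cycle_up_Suc permutes_id intro!: permutes_compose permutes_swap_id)

lemma sign_cycle_up: "sign (cycle_up a n) = (-1) ^ n"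
proof (induction n)
  case (Suc n)
  have "permutation (cycle_up a n)"
    using cycle_up_permutes[of a n "Suc (a + n)"] by (intro permutes_imp_permutation[of "{..<Suc (a + n)}"]) auto
  then have "sign (transpose (a + n) (a + Suc n) \<circ> cycle_up a n)
      = sign (transpose (a + n) (a + Suc n)) * sign (cycle_up a n)"
    by (rule sign_compose[OF permutation_swap_id])
  then show ?case by (simp only: cycle_up_Suc sign_swap_id Suc) simp
qed (simp add: cycle_up_0)

lemma inv_cycle_up: "inv (cycle_up a n) k = (if k = a + n then a else if a \<le> k \<and> k < a + n then Suc k else k)"
proof (rule inv_f_eq)
  show "inj (cycle_up a n)"
    using cycle_up_permutes[of a n "Suc (a + n)"] by (auto intro: permutes_inj)
qed (auto simp: cycle_up_def)

lemma finite_shuffles_of: "finite (shuffles_of p n)"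
  by (rule finite_subset[of _ "{\<sigma>. \<sigma> permutes {..<n}}"]) (auto simp: shuffles_of_def finite_permutations)

lemma strict_mono_on_permutes_id:
  fixes n :: nat
  assumes "\<sigma> permutes {..<n}" "strict_mono_on {..<n} \<sigma>"
  shows "\<sigma> = id"
proof (rule permutes_natset_ge[OF assms(1)])
  have "k \<le> \<sigma> k" if "k < n" for k
    using that
  proof (induction k)
    case (Suc k)
    then have "\<sigma> k < \<sigma> (Suc k)" using assms(2) by (auto simp: strict_mono_on_def)
    then show ?case using Suc by simp
  qed simp
  then show "\<forall>i\<in>{..<n}. i \<le> \<sigma> i" by simp
qed

lemma shuffles_of_trivial: "p = 0 \<or> p = n \<Longrightarrow> shuffles_of p n = {id}"
  using strict_mono_on_permutes_id[of _ n]
  by (fastforce simp: shuffles_of_def permutes_id strict_mono_on_def simp flip: lessThan_atLeast0)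

text \<open>
  The last position of the shuffled word comes from the end of one of the two blocks. If it is the
  end of the second block, the permutation fixes it; if it is the end of the first, the
  permutation is a smaller shuffle after moving that position to the end.
\<close>

lemma shuffles_of_Suc:
  assumes p: "0 < p" "p \<le> n"
  shows "shuffles_of p (Suc n)
    = shuffles_of p n \<union> (\<lambda>\<sigma>. \<sigma> \<circ> cycle_up (p - 1) (Suc n - p)) ` shuffles_of (p - 1) n"
    (is "_ = _ \<union> (\<lambda>\<sigma>. \<sigma> \<circ> ?c) ` _")
proof (intro equalityI subsetI)
  have n: "p - 1 + (Suc n - p) = n" using p by simp
  have c: "?c permutes {..<Suc n}" using n by (intro cycle_up_permutes) simp
  fix \<sigma> assume "\<sigma> \<in> shuffles_of p (Suc n)"
  then have \<sigma>: "\<sigma> permutes {..<Suc n}" and m1: "\<And>i j. i < j \<Longrightarrow> j < p \<Longrightarrow> \<sigma> i < \<sigma> j"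
    and m2: "\<And>i j. p \<le> i \<Longrightarrow> i < j \<Longrightarrow> j < Suc n \<Longrightarrow> \<sigma> i < \<sigma> j"
    by (auto simp: shuffles_of_def strict_mono_on_def)
  have le: "\<sigma> i \<le> n" if "i \<le> n" for i
    using permutes_in_image[OF \<sigma>, of i] that by simp
  obtain k where k: "\<sigma> k = n" "k \<le> n"
    using permutes_surj[OF \<sigma>] permutes_in_image[OF \<sigma>] by (metis lessThan_iff less_Suc_eq_le order_refl surjD)
  \<comment> \<open>The preimage of the largest value is the end of a block, as \<open>\<sigma>\<close> is increasing on blocks.\<close>
  have "k = p - 1 \<or> k = n"
  proof (rule ccontr)
    assume "\<not> ?thesis"
    then consider "k < p - 1" | "p \<le> k" "k < n" using k(2) by linarith
    then show False
    proof cases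
      case 1
      then have "n < \<sigma> (p - 1)" using m1[of k "p - 1"] k p by simp
      moreover have "\<sigma> (p - 1) \<le> n" using p by (intro le) simp
      ultimately show False by simp
    next
      case 2
      then have "n < \<sigma> n" using m2[of k n] k by simp
      then show False using le[of n] by simp
    qed
  qed
  then show "\<sigma> \<in> shuffles_of p n \<union> (\<lambda>\<sigma>. \<sigma> \<circ> ?c) ` shuffles_of (p - 1) n"
  proof
    assume "k = n"
    then have "\<sigma> permutes {..<n}"
      using k by (intro permutes_superset[OF \<sigma>]) auto
    then have "\<sigma> \<in> shuffles_of p n"
      using m1 m2 by (auto simp: shuffles_of_def strict_mono_on_def)
    then show ?thesis by simp
  next
    assume kp: "k = p - 1"
    let ?\<tau> = "\<sigma> \<circ> inv ?c"
    have "?\<tau> permutes {..<Suc n}"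
      by (rule permutes_compose[OF permutes_inv[OF c] \<sigma>])
    then have "?\<tau> permutes {..<n}"
      by (rule permutes_superset) (use k kp n in \<open>auto simp: inv_cycle_up\<close>)
    then have "?\<tau> \<in> shuffles_of (p - 1) n"
      using m1 m2 p by (auto simp: shuffles_of_def strict_mono_on_def inv_cycle_up)
    moreover have "\<sigma> = ?\<tau> \<circ> ?c"
      using permutes_inv_o(2)[OF c] by (simp add: comp_assoc)
    ultimately show ?thesis by blast
  qed
next
  have n: "p - 1 + (Suc n - p) = n" using p by simp
  have c: "?c permutes {..<Suc n}" using n by (intro cycle_up_permutes) simp
  fix \<sigma> assume "\<sigma> \<in> shuffles_of p n \<union> (\<lambda>\<sigma>. \<sigma> \<circ> ?c) ` shuffles_of (p - 1) n"
  then show "\<sigma> \<in> shuffles_of p (Suc n)"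
  proof
    assume "\<sigma> \<in> shuffles_of p n"
    then have \<sigma>: "\<sigma> permutes {..<n}" and m1: "\<And>i j. i < j \<Longrightarrow> j < p \<Longrightarrow> \<sigma> i < \<sigma> j"
      and m2: "\<And>i j. p \<le> i \<Longrightarrow> i < j \<Longrightarrow> j < n \<Longrightarrow> \<sigma> i < \<sigma> j"
      by (auto simp: shuffles_of_def strict_mono_on_def)
    have "\<sigma> n = n" using \<sigma> by (auto simp: permutes_def)
    moreover have "\<sigma> i < n" if "i < n" for i using permutes_in_image[OF \<sigma>, of i] that by simp
    ultimately have "\<sigma> i < \<sigma> j" if "p \<le> i" "i < j" "j < Suc n" for i j
      using m2 that by (cases "j = n") auto
    then show ?thesis
      using m1 permutes_subset[OF \<sigma>, of "{..<Suc n}"] by (auto simp: shuffles_of_def strict_mono_on_def)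
  next
    assume "\<sigma> \<in> (\<lambda>\<sigma>. \<sigma> \<circ> ?c) ` shuffles_of (p - 1) n"
    then obtain \<tau> where s: "\<sigma> = \<tau> \<circ> ?c" and "\<tau> \<in> shuffles_of (p - 1) n" by blast
    then have \<tau>: "\<tau> permutes {..<n}" and m1: "\<And>i j. i < j \<Longrightarrow> j < p - 1 \<Longrightarrow> \<tau> i < \<tau> j"
      and m2: "\<And>i j. p - 1 \<le> i \<Longrightarrow> i < j \<Longrightarrow> j < n \<Longrightarrow> \<tau> i < \<tau> j"
      by (auto simp: shuffles_of_def strict_mono_on_def)
    have tn: "\<tau> n = n" using \<tau> by (auto simp: permutes_def)
    have tl: "\<tau> i < n" if "i < n" for i using permutes_in_image[OF \<tau>, of i] that by simp
    have "\<sigma> permutes {..<Suc n}"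
      unfolding s by (rule permutes_compose[OF c permutes_subset[OF \<tau>]]) simp
    moreover have "\<sigma> i < \<sigma> j" if "i < j" "j < p" for i j
      using m1[of i j] tl[of i] that p n tn by (cases "j = p - 1") (auto simp: s cycle_up_def)
    moreover have "\<sigma> i < \<sigma> j" if "p \<le> i" "i < j" "j < Suc n" for i j
      using m2[of "i - 1" "j - 1"] that p n by (auto simp: s cycle_up_def)
    ultimately show ?thesis by (auto simp: shuffles_of_def strict_mono_on_def)
  qed
qed

context graded_vector_space
begin

lemma prod_powi: "(\<Prod>i\<in>I. (-1) powi f i) = ((-1) powi (\<Sum>i\<in>I. f i) :: 'k)"
  by (induction I rule: infinite_finite_induct) (simp_all add: power_int_add)

lemma koszul_sign_snoc:
  assumes "\<sigma> permutes {..<length ps}"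
  shows "koszul_sign \<sigma> (ps @ [p]) = koszul_sign \<sigma> ps"
proof -
  have fix_last: "\<sigma> (length ps) = length ps" using assms by (auto simp: permutes_def)
  have less: "\<sigma> k < length ps" if "k < length ps" for k
    using permutes_in_image[OF assms, of k] that by simp
  have "{(a, b). a < b \<and> b < length (ps @ [p]) \<and> \<sigma> b < \<sigma> a}
      = {(a, b). a < b \<and> b < length ps \<and> \<sigma> b < \<sigma> a}" (is "?I = ?J")
  proof (rule Collect_cong, clarify)
    fix a b
    show "(a < b \<and> b < length (ps @ [p]) \<and> \<sigma> b < \<sigma> a) = (a < b \<and> b < length ps \<and> \<sigma> b < \<sigma> a)"
      using fix_last less[of a] by (cases "b = length ps") auto
  qed
  moreover have "(\<Prod>(a, b)\<in>?J. (-1) powi ((ps @ [p]) ! a * (ps @ [p]) ! b))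
      = (\<Prod>(a, b)\<in>?J. (-1) powi (ps ! a * ps ! b) :: 'k)"
    by (rule prod.cong[OF refl]) (clarsimp simp: nth_append)
  ultimately show ?thesis unfolding koszul_sign_def by simp
qed

text \<open>
  The entry that is moved to the end forms an inversion with every later entry; the other
  inversions are those of \<open>\<sigma>\<close>, renumbered by the positions that the cycle skips.
\<close>

lemma koszul_sign_cycle_up:
  assumes \<sigma>: "\<sigma> permutes {..<length ps + length qs}"
  shows "koszul_sign (\<sigma> \<circ> cycle_up (length ps) (length qs)) (ps @ r # qs)
    = (-1) powi (r * sum_list qs) * koszul_sign \<sigma> (ps @ qs)"
proof -
  let ?a = "length ps" and ?n = "length ps + length qs" and ?c = "cycle_up (length ps) (length qs)"
  let ?\<tau> = "\<sigma> \<circ> ?c"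
  \<comment> \<open>The inverse of the cycle on positions other than its end; it skips \<open>?a\<close>.\<close>
  define e where "e k = (if k < ?a then k else Suc k)" for k
  have ce: "?c (e k) = k" if "k < ?n" for k using that by (simp add: cycle_up_def e_def)
  have \<sigma>n: "\<sigma> ?n = ?n" using \<sigma> by (auto simp: permutes_def)
  have \<sigma>l: "\<sigma> k < ?n" if "k < ?n" for k using permutes_in_image[OF \<sigma>, of k] that by simp
  have e_cases: "k = ?a \<or> (\<exists>l<?n. k = e l)" if "k < Suc ?n" for k
  proof (cases "k < ?a")
    case True
    then show ?thesis by (intro disjI2 exI[of _ k]) (simp add: e_def)
  next
    case False
    then show ?thesis using that by (cases "k = ?a") (auto simp: e_def intro!: exI[of _ "k - 1"])
  qed
  have e_less: "e k < e l \<longleftrightarrow> k < l" and e_a: "e k \<noteq> ?a" and e_n: "k < ?n \<Longrightarrow> e k < Suc ?n" for k l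
    by (auto simp: e_def)
  have ca: "?c ?a = ?n" by (simp add: cycle_up_def)
  let ?I = "{(a, b). a < b \<and> b < Suc ?n \<and> ?\<tau> b < ?\<tau> a}"
  let ?J = "{(a, b). a < b \<and> b < ?n \<and> \<sigma> b < \<sigma> a}"
  have I: "?I = Pair ?a ` {Suc ?a..<Suc ?n} \<union> map_prod e e ` ?J"
  proof (intro equalityI subsetI)
    fix z assume "z \<in> ?I"
    then obtain i j where z: "z = (i, j)" "i < j" "j < Suc ?n" "?\<tau> j < ?\<tau> i" by auto
    have j: "j \<noteq> ?a"
    proof
      assume "j = ?a"
      then have "?\<tau> i = \<sigma> i" "?\<tau> j = ?n" "i < ?n" using z ca \<sigma>n by (auto simp: cycle_up_def)
      then show False using z(4) \<sigma>l[of i] by simp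
    qed
    then obtain l where l: "l < ?n" "j = e l" using e_cases z(3) by blast
    show "z \<in> Pair ?a ` {Suc ?a..<Suc ?n} \<union> map_prod e e ` ?J"
    proof (cases "i = ?a")
      case True
      then show ?thesis using z by auto
    next
      case False
      then obtain k where k: "k < ?n" "i = e k" using e_cases[of i] z by auto
      have "(k, l) \<in> ?J" using z k l by (auto simp: e_less ce)
      then show ?thesis using z k l by (auto intro!: image_eqI[of _ _ "(k, l)"])
    qed
  next
    fix z assume "z \<in> Pair ?a ` {Suc ?a..<Suc ?n} \<union> map_prod e e ` ?J"
    then show "z \<in> ?I"
    proof
      assume "z \<in> Pair ?a ` {Suc ?a..<Suc ?n}"
      then obtain j where z: "z = (?a, j)" "?a < j" "j < Suc ?n" by auto
      have "?\<tau> j < ?n" using z \<sigma>l[of "j - 1"] by (auto simp: cycle_up_def)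
      then show ?thesis using z ca \<sigma>n by simp
    next
      assume "z \<in> map_prod e e ` ?J"
      then obtain k l where "z = (e k, e l)" "k < l" "l < ?n" "\<sigma> l < \<sigma> k" by auto
      then show ?thesis by (auto simp: e_less ce e_n)
    qed
  qed
  have finJ: "finite ?J" by (rule finite_subset[of _ "{..<?n} \<times> {..<?n}"]) auto
  have disj: "Pair ?a ` {Suc ?a..<Suc ?n} \<inter> map_prod e e ` ?J = {}" using e_a by fastforce
  have inj: "inj_on (map_prod e e) ?J" by (auto simp: inj_on_def e_def split: if_splits)
  let ?w = "ps @ r # qs"
  have we: "?w ! e k = (ps @ qs) ! k" if "k < ?n" for k
    using that by (auto simp: e_def nth_append Suc_diff_le)
  have "koszul_sign ?\<tau> ?w = (\<Prod>(a, b)\<in>?I. (-1) powi (?w ! a * ?w ! b))"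
    by (simp add: koszul_sign_def)
  also have "\<dots> = (\<Prod>(a, b)\<in>Pair ?a ` {Suc ?a..<Suc ?n}. (-1) powi (?w ! a * ?w ! b))
      * (\<Prod>(a, b)\<in>map_prod e e ` ?J. (-1) powi (?w ! a * ?w ! b))"
    unfolding I by (rule prod.union_disjoint) (use finJ disj in auto)
  also have "(\<Prod>(a, b)\<in>Pair ?a ` {Suc ?a..<Suc ?n}. (-1) powi (?w ! a * ?w ! b))
      = ((-1) powi (r * sum_list qs) :: 'k)"
  proof -
    have "(\<Prod>(a, b)\<in>Pair ?a ` {Suc ?a..<Suc ?n}. (-1) powi (?w ! a * ?w ! b))
        = (\<Prod>b\<in>{Suc ?a..<Suc ?n}. (-1) powi (r * ?w ! b) :: 'k)"
      by (subst prod.reindex) (auto simp: inj_on_def)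
    also have "\<dots> = (\<Prod>b<length qs. (-1) powi (r * qs ! b))"
      by (rule prod.reindex_bij_witness[of _ "\<lambda>b. b + Suc ?a" "\<lambda>b. b - Suc ?a"])
        (auto simp: nth_append nth_Cons')
    finally show ?thesis
      by (simp add: prod_powi sum_list_sum_nth sum_distrib_left atLeast0LessThan)
  qed
  also have "(\<Prod>(a, b)\<in>map_prod e e ` ?J. (-1) powi (?w ! a * ?w ! b)) = koszul_sign \<sigma> (ps @ qs)"
    unfolding koszul_sign_def by (subst prod.reindex[OF inj]) (auto intro!: prod.cong simp: we)
  finally show ?thesis .
qed

lemma koszul_sign_id [simp]: "koszul_sign id ps = 1"
proof -
  have "{(a, b). a < b \<and> b < length ps \<and> id b < id a} = {}" by auto
  then show ?thesis unfolding koszul_sign_def by (simp only: prod.empty)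
qed

definition unsuspended :: "'u word \<Rightarrow> int list" where
  "unsuspended zs = map (\<lambda>z. fst z - 1) zs"

lemma unsuspended_simps [simp]:
  "unsuspended [] = []" "unsuspended (z # zs) = (fst z - 1) # unsuspended zs"
  "unsuspended (v @ w) = unsuspended v @ unsuspended w" "length (unsuspended v) = length v"
  by (simp_all add: unsuspended_def)

lemma sum_list_unsuspended: "sum_list (unsuspended zs) = deg zs - int (length zs)"
  by (induction zs) (auto simp: unsuspended_def)

text \<open>
  One summand of a balance condition, with the decalage sign of the permuted word.
\<close>

definition shuffle_term :: "('u word \<Rightarrow> 'u) \<Rightarrow> 'u word \<Rightarrow> (nat \<Rightarrow> nat) \<Rightarrow> 'u" where
  "shuffle_term \<phi> zs \<sigma> = (of_int (sign \<sigma>) * koszul_sign \<sigma> (unsuspended zs)) *s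
    signed (susp_exp (permute_list (inv \<sigma>) zs)) (\<phi> (permute_list (inv \<sigma>) zs))"

lemma deg_mset: "mset v = mset w \<Longrightarrow> deg v = deg w"
  by (simp add: deg_def flip: sum_mset_sum_list)

lemma shuffle_term_snoc:
  assumes \<sigma>: "\<sigma> permutes {..<length zs}"
  shows "shuffle_term \<phi> (zs @ [z]) \<sigma>
    = signed (deg zs - int (length zs)) (shuffle_term (\<lambda>v. \<phi> (v @ [z])) zs \<sigma>)"
proof -
  have inv: "inv \<sigma> permutes {..<length zs}" by (rule permutes_inv[OF \<sigma>])
  then have "inv \<sigma> (length zs) = length zs" by (auto simp: permutes_def)
  moreover have "inv \<sigma> k < length zs" if "k < length zs" for k
    using permutes_in_image[OF inv, of k] that by simp
  ultimately have w: "permute_list (inv \<sigma>) (zs @ [z]) = permute_list (inv \<sigma>) zs @ [z]"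
    by (auto simp: permute_list_def nth_append)
  have k: "koszul_sign \<sigma> (unsuspended (zs @ [z])) = koszul_sign \<sigma> (unsuspended zs)"
    using koszul_sign_snoc[of \<sigma> "unsuspended zs"] \<sigma> by (simp add: unsuspended_def)
  have "deg (permute_list (inv \<sigma>) zs) = deg zs"
    by (rule deg_mset) (simp add: inv)
  then show ?thesis
    unfolding shuffle_term_def w k susp_exp_append signed_scale by (simp add: algebra_simps)
qed

text \<open>
  The three contributions to the exponent are the sign of the cycle, the Koszul sign of moving \<open>x\<close>
  past \<open>ys\<close>, and the change of the decalage sign when the last letter is split off.
\<close>

lemma shuffle_term_cycle_up:
  assumes \<sigma>: "\<sigma> permutes {..<length xs + length ys}"
  shows "shuffle_term \<phi> (xs @ x # ys) (\<sigma> \<circ> cycle_up (length xs) (length ys))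
    = signed (int (length ys) + (fst x - 1) * (deg ys - int (length ys))
        + (deg (xs @ ys) - int (length (xs @ ys))))
      (shuffle_term (\<lambda>v. \<phi> (v @ [x])) (xs @ ys) \<sigma>)"
proof -
  let ?c = "cycle_up (length xs) (length ys)" and ?n = "length xs + length ys"
  have c: "?c permutes {..<Suc ?n}" by (rule cycle_up_permutes) simp
  have \<sigma>': "\<sigma> permutes {..<Suc ?n}" by (rule permutes_subset[OF \<sigma>]) auto
  have inv: "inv \<sigma> permutes {..<?n}" by (rule permutes_inv[OF \<sigma>])
  have inv_comp: "inv (\<sigma> \<circ> ?c) = inv ?c \<circ> inv \<sigma>"
    by (rule o_inv_distrib[OF permutes_bij[OF \<sigma>'] permutes_bij[OF c]])
  have "inv \<sigma> ?n = ?n" using inv by (auto simp: permutes_def)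
  moreover have "inv \<sigma> k < ?n" "inv \<sigma> k \<noteq> ?n" if "k < ?n" for k
    using permutes_in_image[OF inv, of k] that by simp_all
  ultimately have w: "permute_list (inv (\<sigma> \<circ> ?c)) (xs @ x # ys) = permute_list (inv \<sigma>) (xs @ ys) @ [x]"
    unfolding inv_comp
    by (auto simp: permute_list_def nth_append nth_Cons' inv_cycle_up)
  have k: "koszul_sign (\<sigma> \<circ> ?c) (unsuspended (xs @ x # ys))
      = (-1) powi ((fst x - 1) * (deg ys - int (length ys))) * koszul_sign \<sigma> (unsuspended (xs @ ys))"
    using koszul_sign_cycle_up[of \<sigma> "unsuspended xs" "unsuspended ys"] \<sigma>
    by (simp add: sum_list_unsuspended)
  have s: "of_int (sign (\<sigma> \<circ> ?c)) = (of_int (sign \<sigma>) * (-1) powi (int (length ys)) :: 'k)"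
    using sign_compose[of \<sigma> ?c] sign_cycle_up[of "length xs" "length ys"]
      permutes_imp_permutation[OF _ \<sigma>'] permutes_imp_permutation[OF _ c] by simp
  have d: "deg (permute_list (inv \<sigma>) (xs @ ys)) = deg (xs @ ys)"
    by (rule deg_mset) (simp add: inv)
  have pull: "(A * (-1) powi p * ((-1) powi q * B)) *s v = signed (p + q) ((A * B) *s v)" for A B p q v
    by (auto simp: signed_def)
  show ?thesis
    unfolding shuffle_term_def w k s pull susp_exp_append d signed_scale signed_simps
    by (rule arg_cong[where f = "\<lambda>v. _ *s v"], rule signed_cong) simp
qed

text \<open>
  The sign of the permutation and the Koszul sign of unsuspended degrees combine, through the
  decalage sign, to the Koszul sign of suspended degrees. Both sides obey the same recursion on
  the last letter.
\<close>

theorem sum_shuffles_of: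
  assumes "p \<le> length zs"
  shows "(\<Sum>\<sigma>\<in>shuffles_of p (length zs). shuffle_term \<phi> zs \<sigma>)
    = signed (susp_exp zs) (shuffle \<phi> (take p zs) (drop p zs))"
  using assms
proof (induction "length zs" arbitrary: zs p \<phi>)
  case 0
  then show ?case
    by (simp add: shuffles_of_trivial shuffle_term_def koszul_sign_id[unfolded id_def])
next
  case (Suc n)
  show ?case
  proof (cases "p = 0 \<or> p = length zs")
    case True
    then have "shuffle \<phi> (take p zs) (drop p zs) = \<phi> zs" by auto
    then show ?thesis
      using shuffles_of_trivial[OF True] by (simp add: shuffle_term_def)
  next
    case False
    then have p: "0 < p" "p \<le> n" using Suc.hyps(2) Suc.prems by auto
    obtain xs x where xs: "take p zs = xs @ [x]"
      using p Suc.hyps(2) by (cases "take p zs" rule: rev_cases) auto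
    obtain ys y where ys: "drop p zs = ys @ [y]"
      using p Suc.hyps(2) by (cases "drop p zs" rule: rev_cases) auto
    have zs: "zs = xs @ [x] @ ys @ [y]"
      using append_take_drop_id[of p zs] unfolding xs ys by simp
    have lx: "length xs = p - 1" and ly: "length ys = n - p"
      using arg_cong[OF xs, of length] arg_cong[OF ys, of length] Suc.hyps(2) p by auto
    let ?c = "cycle_up (p - 1) (Suc n - p)"
    have c: "?c = cycle_up (length xs) (length (ys @ [y]))" using lx ly p by (simp add: Suc_diff_le)
    have inj: "inj_on (\<lambda>\<sigma>. \<sigma> \<circ> ?c) (shuffles_of (p - 1) n)"
    proof (rule inj_onI)
      have "surj ?c"
        by (rule permutes_surj[OF cycle_up_permutes[of _ _ "Suc n"]]) (use p in simp)
      fix \<sigma> \<tau> assume "\<sigma> \<circ> ?c = \<tau> \<circ> ?c"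
      then have "\<sigma> (?c k) = \<tau> (?c k)" for k by (metis comp_apply)
      then show "\<sigma> = \<tau>" using \<open>surj ?c\<close> by (metis ext surjD)
    qed
    have disj: "shuffles_of p n \<inter> (\<lambda>\<sigma>. \<sigma> \<circ> ?c) ` shuffles_of (p - 1) n = {}"
    proof -
      have "\<tau> \<circ> ?c \<noteq> \<sigma>" if "\<sigma> permutes {..<n}" "\<tau> permutes {..<n}" for \<sigma> \<tau>
      proof
        assume e: "\<tau> \<circ> ?c = \<sigma>"
        have "\<sigma> n = n" using that by (auto simp: permutes_def)
        moreover have "(\<tau> \<circ> ?c) n = \<tau> (n - 1)" using p by (auto simp: cycle_up_def)
        moreover have "\<tau> (n - 1) < n" using permutes_in_image[OF that(2), of "n - 1"] p by simp
        ultimately show False using fun_cong[OF e, of n] by simp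
      qed
      then show ?thesis by (fastforce simp: shuffles_of_def)
    qed
    have 1: "(\<Sum>\<sigma>\<in>shuffles_of p n. shuffle_term \<phi> zs \<sigma>)
      = signed (susp_exp zs) (shuffle (\<lambda>v. \<phi> (v @ [y])) (xs @ [x]) ys)"
    proof -
      let ?z = "xs @ [x] @ ys"
      have lz: "length ?z = n" using lx ly p by simp
      have "(\<Sum>\<sigma>\<in>shuffles_of p n. shuffle_term \<phi> zs \<sigma>) = (\<Sum>\<sigma>\<in>shuffles_of p n.
          signed (deg ?z - int n) (shuffle_term (\<lambda>v. \<phi> (v @ [y])) ?z \<sigma>))"
      proof (rule sum.cong[OF refl])
        fix \<sigma> assume "\<sigma> \<in> shuffles_of p n"
        then have "\<sigma> permutes {..<length ?z}" using lz by (simp add: shuffles_of_def)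
        from shuffle_term_snoc[OF this, of \<phi> y]
        show "shuffle_term \<phi> zs \<sigma> = signed (deg ?z - int n) (shuffle_term (\<lambda>v. \<phi> (v @ [y])) ?z \<sigma>)"
          unfolding lz zs by simp
      qed
      also have "\<dots> = signed (deg ?z - int n) (signed (susp_exp ?z)
          (shuffle (\<lambda>v. \<phi> (v @ [y])) (take p ?z) (drop p ?z)))"
        using Suc.hyps(1)[of ?z p "\<lambda>v. \<phi> (v @ [y])"] lz p unfolding signed_sum[symmetric] by simp
      also have "take p ?z = xs @ [x]" using lx p by simp
      also have "drop p ?z = ys" using lx p by simp
      also have "signed (deg ?z - int n) (signed (susp_exp ?z) v) = signed (susp_exp zs) v" for v :: 'u
      proof -
        have "zs = ?z @ [y]" by (simp add: zs)
        then have "deg ?z - int n + susp_exp ?z = susp_exp zs"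
          using susp_exp_append[of ?z "[y]"] lz by simp
        then show ?thesis by (simp only: signed_simps)
      qed
      finally show ?thesis .
    qed
    have 2: "(\<Sum>\<sigma>\<in>shuffles_of (p - 1) n. shuffle_term \<phi> zs (\<sigma> \<circ> ?c))
      = signed (susp_exp zs) (signed (fst x * deg (ys @ [y]))
          (shuffle (\<lambda>v. \<phi> (v @ [x])) xs (ys @ [y])))"
    proof -
      let ?y = "ys @ [y]" let ?z = "xs @ ?y"
      let ?r = "int (length ?y) + (fst x - 1) * (deg ?y - int (length ?y)) + (deg ?z - int (length ?z))"
      have lz: "length ?z = n" using lx ly p by simp
      have "(\<Sum>\<sigma>\<in>shuffles_of (p - 1) n. shuffle_term \<phi> zs (\<sigma> \<circ> ?c)) = (\<Sum>\<sigma>\<in>shuffles_of (p - 1) n.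
          signed ?r (shuffle_term (\<lambda>v. \<phi> (v @ [x])) ?z \<sigma>))"
      proof (rule sum.cong[OF refl])
        fix \<sigma> assume "\<sigma> \<in> shuffles_of (p - 1) n"
        then have "\<sigma> permutes {..<length xs + length ?y}" using lz by (simp add: shuffles_of_def)
        from shuffle_term_cycle_up[OF this, of \<phi> x]
        show "shuffle_term \<phi> zs (\<sigma> \<circ> ?c) = signed ?r (shuffle_term (\<lambda>v. \<phi> (v @ [x])) ?z \<sigma>)"
          unfolding c by (simp add: zs)
      qed
      also have "\<dots> = signed ?r (signed (susp_exp ?z)
          (shuffle (\<lambda>v. \<phi> (v @ [x])) (take (p - 1) ?z) (drop (p - 1) ?z)))"
        using Suc.hyps(1)[of ?z "p - 1" "\<lambda>v. \<phi> (v @ [x])"] lz p unfolding signed_sum[symmetric] by simp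
      also have "take (p - 1) ?z = xs" using lx by simp
      also have "drop (p - 1) ?z = ?y" using lx by simp
      also have "signed ?r (signed (susp_exp ?z) v) = signed (susp_exp zs) (signed (fst x * deg ?y) v)" for v :: 'u
      proof -
        have z1: "susp_exp zs = susp_exp xs + int (length (x # ?y)) * (deg xs - int (length xs))
            + int (length ?y) * (fst x - 1) + susp_exp ?y"
          unfolding zs using susp_exp_append[of xs "x # ?y"] by simp
        have "even (?r + (susp_exp xs + int (length ?y) * (deg xs - int (length xs)) + susp_exp ?y)
            - (susp_exp zs + fst x * deg ?y))"
          unfolding z1 deg_simps(3) length_append of_nat_add list.size of_nat_Suc deg_simps
          by (simp add: algebra_simps)
        then show ?thesis
          unfolding signed_simps susp_exp_append[of xs ?y] by (rule signed_cong)
      qed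
      finally show ?thesis .
    qed
    have "(\<Sum>\<sigma>\<in>shuffles_of p (length zs). shuffle_term \<phi> zs \<sigma>)
      = (\<Sum>\<sigma>\<in>shuffles_of p n. shuffle_term \<phi> zs \<sigma>)
        + (\<Sum>\<sigma>\<in>shuffles_of (p - 1) n. shuffle_term \<phi> zs (\<sigma> \<circ> ?c))"
      unfolding Suc.hyps(2)[symmetric] shuffles_of_Suc[OF p]
      using disj inj by (simp add: sum.union_disjoint finite_shuffles_of sum.reindex)
    then show ?thesis
      unfolding 1 2 xs ys shuffle_snoc signed_add .
  qed
qed

lemma balanced_desuspend:
  assumes b: "slot_linear b" "shuffle_free b"
    and p: "1 \<le> p" "p \<le> i - 1" and l: "length ws = i" and h: "homogeneous ps ws"
  shows "(\<Sum>\<sigma> \<in> shuffles_of p i. (of_int (sign \<sigma>) * koszul_sign \<sigma> ps) *s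
      desuspend b i (map (\<lambda>k. ws ! inv \<sigma> k) [0..<i])) = 0"
proof -
  define zs where "zs = tag ps ws"
  have lp: "length ps = i" using length_homogeneous[OF h] l by simp
  have lz: "length zs = i" using lp l by (simp add: zs_def length_tag)
  have u: "unsuspended zs = ps"
  proof -
    have "unsuspended zs = map (\<lambda>p. p - 1) (map fst zs)" by (simp add: unsuspended_def)
    then show ?thesis using lp l unfolding zs_def by (simp add: map_fst_tag comp_def)
  qed
  have "(of_int (sign \<sigma>) * koszul_sign \<sigma> ps) *s desuspend b i (map (\<lambda>k. ws ! inv \<sigma> k) [0..<i])
      = signed (triangle (i - 1)) (shuffle_term b zs \<sigma>)" if "\<sigma> \<in> shuffles_of p i" for \<sigma>
  proof -
    have inv: "inv \<sigma> permutes {..<i}"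
      using that by (intro permutes_inv) (simp add: shuffles_of_def)
    let ?ws = "permute_list (inv \<sigma>) ws" and ?ps = "permute_list (inv \<sigma>) ps"
    have h': "homogeneous ?ps ?ws"
      unfolding homogeneous_def
      by (subst list_all2_permute_list_iff) (use h inv lp l in \<open>simp_all add: homogeneous_def\<close>)
    have t: "tag ?ps ?ws = permute_list (inv \<sigma>) zs"
    proof -
      have "permute_list (inv \<sigma>) (zip (map (\<lambda>p. p + 1) ps) ws)
          = zip (permute_list (inv \<sigma>) (map (\<lambda>p. p + 1) ps)) ?ws"
        by (rule permute_list_zip[OF inv]) (simp_all add: lp l)
      also have "permute_list (inv \<sigma>) (map (\<lambda>p. p + 1) ps) = map (\<lambda>p. p + 1) ?ps"
        by (rule permute_list_map) (simp add: lp inv)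
      finally show ?thesis by (simp only: tag_def zs_def)
    qed
    have w: "map (\<lambda>k. ws ! inv \<sigma> k) [0..<i] = ?ws" by (simp add: permute_list_def l)
    have D: "desuspend b i ?ws
        = signed (susp_exp (permute_list (inv \<sigma>) zs) + triangle (i - 1)) (b (permute_list (inv \<sigma>) zs))"
      using desuspend_homogeneous[OF b(1) h'] unfolding t .
    show ?thesis
      unfolding shuffle_term_def u w D signed_scale[symmetric] signed_simps by (simp only: add.commute)
  qed
  then have "(\<Sum>\<sigma> \<in> shuffles_of p i. (of_int (sign \<sigma>) * koszul_sign \<sigma> ps) *s
      desuspend b i (map (\<lambda>k. ws ! inv \<sigma> k) [0..<i]))
      = signed (triangle (i - 1)) (\<Sum>\<sigma> \<in> shuffles_of p i. shuffle_term b zs \<sigma>)"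
    unfolding signed_sum by (rule sum.cong[OF refl])
  also have "(\<Sum>\<sigma> \<in> shuffles_of p i. shuffle_term b zs \<sigma>)
      = signed (susp_exp zs) (shuffle b (take p zs) (drop p zs))"
    using sum_shuffles_of[of p zs b] p lz by simp
  also have "shuffle b (take p zs) (drop p zs) = 0"
  proof -
    have "take p zs \<noteq> []" "drop p zs \<noteq> []" using p lz by auto
    then show ?thesis using b(2) unfolding shuffle_free_def by blast
  qed
  finally show ?thesis by simp
qed

end

section \<open>Contraction onto a strictly commutative product\<close>

lemma (in graded_chain_complex) lin_d: "lin d"
  by (rule linear_d)

lemma (in graded_chain_complex) component_d: "component (d x) p = d (component x (p + 1))"
proof -
  have "component (d x) = (\<lambda>p. d (component x (p + 1)))"
  proof (rule component_unique)
    let ?S = "{p. component x p \<noteq> 0}"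
    show "finite ((\<lambda>p. p - 1) ` ?S)" using component(2) by simp
    show "d (component x (p + 1)) \<in> U p" for p
      using degree_d[OF component(1)[of x "p + 1"]] by simp
    show "d (component x (p + 1)) = 0" if "p \<notin> (\<lambda>p. p - 1) ` ?S" for p
    proof -
      have "component x (p + 1) = 0"
      proof (rule ccontr)
        assume "component x (p + 1) \<noteq> 0"
        then have "p \<in> (\<lambda>p. p - 1) ` ?S" by (intro image_eqI[of _ _ "p + 1"]) auto
        then show False using that by simp
      qed
      then show ?thesis by (simp add: linD(3)[OF lin_d])
    qed
    have "(\<Sum>p\<in>(\<lambda>p. p - 1) ` ?S. d (component x (p + 1))) = (\<Sum>p\<in>?S. d (component x p))"
      by (subst sum.reindex) (auto simp: inj_on_def)
    then show "(\<Sum>p\<in>(\<lambda>p. p - 1) ` ?S. d (component x (p + 1))) = d x"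
      using component(3)[of x] by (simp flip: linD(7)[OF lin_d])
  qed
  then show ?thesis by simp
qed

text \<open>
  Linear right inverses on the image exist over a field; this is the step that splits off the
  homology.
\<close>

lemma (in graded_chain_complex) generalized_inverse: "\<exists>g. lin g \<and> (\<forall>x. d (g (d x)) = d x)"
proof -
  interpret vector_space_pair scale scale by (rule linear_pair)
  show ?thesis using linear_exists_right_inverse_on[OF lin_d, of UNIV] by auto
qed

context graded_vector_space
begin

text \<open>
  The suspended cochain of a unary and a binary operation. The sign of the binary part is the
  decalage sign of arity two.
\<close>

definition cochain_upto_2 :: "('u \<Rightarrow> 'u) \<Rightarrow> (int \<Rightarrow> int \<Rightarrow> 'u \<Rightarrow> 'u \<Rightarrow> 'u) \<Rightarrow> 'u word \<Rightarrow> 'u" where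
  "cochain_upto_2 D B ws = (case ws of [w] \<Rightarrow> D (snd w)
    | [w, w'] \<Rightarrow> signed (fst w - 1) (B (fst w - 1) (fst w' - 1) (snd w) (snd w'))
    | _ \<Rightarrow> 0)"

lemma cochain_upto_2_simps [simp]:
  "cochain_upto_2 D B [] = 0" "cochain_upto_2 D B [w] = D (snd w)"
  "cochain_upto_2 D B [w, w'] = signed (fst w - 1) (B (fst w - 1) (fst w' - 1) (snd w) (snd w'))"
  "cochain_upto_2 D B (w # w' # w'' # ws) = 0"
  by (simp_all add: cochain_upto_2_def)

lemma cochain_upto_2_long: "3 \<le> length ws \<Longrightarrow> cochain_upto_2 D B ws = 0"
  by (auto simp: cochain_upto_2_def split: list.splits)

lemma slot_linear_cochain_upto_2:
  assumes "lin D" "\<And>p q u. lin (B p q u)" "\<And>p q v. lin (\<lambda>u. B p q u v)"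
  shows "slot_linear (cochain_upto_2 D B)"
  unfolding slot_linear_def
proof (intro allI)
  fix a b :: "'u word" and q
  consider "a = []" "b = []" | z where "a = []" "b = [z]" | z where "a = [z]" "b = []"
    | "2 \<le> length a + length b"
    by (cases a; cases b; cases "tl a"; cases "tl b") auto
  then show "lin (\<lambda>x. cochain_upto_2 D B (a @ (q, x) # b))"
  proof cases
    case 4
    then show ?thesis by (simp add: cochain_upto_2_long lin_intros(2))
  qed (simp_all add: assms lin_intros(6))
qed

lemma graded_cochain_upto_2:
  assumes "\<And>p u. u \<in> U p \<Longrightarrow> D u \<in> U (p + e)"
    "\<And>p q u v. u \<in> U p \<Longrightarrow> v \<in> U q \<Longrightarrow> B p q u v \<in> U (p + q + e + 1)"
  shows "graded_cochain e (cochain_upto_2 D B)"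
  unfolding graded_cochain_def
proof (intro allI impI)
  fix ws :: "'u word" assume h: "hom_word ws" and ne: "ws \<noteq> []"
  consider w where "ws = [w]" | w w' where "ws = [w, w']" | "3 \<le> length ws"
    using ne by (cases ws; cases "tl ws"; cases "tl (tl ws)") auto
  then show "cochain_upto_2 D B ws \<in> U (deg ws + e - 1)"
  proof cases
    case (1 w)
    then show ?thesis using h assms(1)[of "snd w" "fst w - 1"] by (simp add: algebra_simps)
  next
    case (2 w w')
    then show ?thesis
      using h assms(2)[of "snd w" "fst w - 1" "snd w'" "fst w' - 1"] by (simp add: algebra_simps)
  next
    case 3
    then show ?thesis by (simp add: cochain_upto_2_long subspace_0[OF subspace_component])
  qed
qed

text \<open>
  Only shuffles of two single letters matter; there, suspension turns symmetry into antisymmetry.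
\<close>

lemma shuffle_free_cochain_upto_2:
  assumes sym: "\<And>p q u v. B p q u v = signed (p * q) (B q p v u)"
  shows "shuffle_free (cochain_upto_2 D B)"
  unfolding shuffle_free_def
proof (intro allI impI)
  fix xs ys :: "'u word" assume ne: "xs \<noteq> []" "ys \<noteq> []"
  show "shuffle (cochain_upto_2 D B) xs ys = 0"
  proof (cases "length xs + length ys \<le> 2")
    case True
    then obtain x y where xy: "xs = [x]" "ys = [y]"
      using ne by (cases xs; cases ys) auto
    have "signed q z = - signed r z" if "odd (q - r)" for q r and z :: 'u
      using that by (auto simp: signed_def)
    then have "signed (fst y * fst x + (fst y - 1)) (B (fst y - 1) (fst x - 1) (snd y) (snd x))
      = - signed (fst x - 1 + (fst x - 1) * (fst y - 1)) (B (fst y - 1) (fst x - 1) (snd y) (snd x))"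
      by (auto simp: algebra_simps)
    then show ?thesis
      unfolding xy by (simp add: sym[of "fst x - 1"])
  next
    case False
    have "shuffle (cochain_upto_2 D B) xs ys = shuffle (\<lambda>v. 0) xs ys"
      by (rule length_shuffle_cong) (use False in \<open>simp add: cochain_upto_2_long\<close>)
    then show ?thesis by simp
  qed
qed

end

text \<open>
  The choices from which the retraction and its homotopies are built. The map \<open>g\<close> may mix degrees;
  its part of degree one is taken below.
\<close>

locale contraction = associative_dg_algebra scale U d \<mu>
  for scale :: "'k::field_char_0 \<Rightarrow> 'u::ab_group_add \<Rightarrow> 'u" (infixr \<open>*s\<close> 75)
    and U :: "int \<Rightarrow> 'u set" and d :: "'u \<Rightarrow> 'u" and \<mu> :: "'u \<Rightarrow> 'u \<Rightarrow> 'u" +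
  fixes g :: "'u \<Rightarrow> 'u" and h :: "'u \<Rightarrow> 'u \<Rightarrow> 'u"
  assumes g_linear: "lin g" and d_g_d: "d (g (d x)) = d x"
    and h_bilinear: "graded_bilinear 1 h"
    and h_homotopy: "u \<in> U p \<Longrightarrow> v \<in> U q \<Longrightarrow>
      d (h u v) + (h (d u) v + (-1) powi p *s h u (d v)) = \<mu> u v - (-1) powi (p * q) *s \<mu> v u"
begin

lemma d_simps [simp]: "d (x + y) = d x + d y" "d (x - y) = d x - d y" "d 0 = 0" "d (- x) = - d x"
  "d (signed q x) = signed q (d x)" "d (c *s x) = c *s d x" "d (d x) = 0"
  using linD[OF lin_d] d_d by auto

lemma lin_\<mu>: "lin (\<mu> u)" "lin (\<lambda>u. \<mu> u v)"
  and \<mu>_mem: "u \<in> U p \<Longrightarrow> v \<in> U q \<Longrightarrow> \<mu> u v \<in> U (p + q)"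
  using graded_bilinear_mult unfolding graded_bilinear_def by auto

lemma lin_h: "lin (h u)" "lin (\<lambda>u. h u v)"
  and h_mem: "u \<in> U p \<Longrightarrow> v \<in> U q \<Longrightarrow> h u v \<in> U (p + q + 1)"
  using h_bilinear unfolding graded_bilinear_def by auto

lemmas U_intros = subspace_add[OF subspace_component] subspace_diff[OF subspace_component]
  subspace_scale[OF subspace_component] signed_in_U

text \<open>
  The part of \<open>g\<close> of degree one.
\<close>

definition K :: "int \<Rightarrow> 'u \<Rightarrow> 'u" where
  "K p u = component (g u) (p + 1)"

text \<open>
  In homology \<open>P\<close> is the identity, since it is homotopic to it; as it kills boundaries and has
  values in cycles, it represents each class by one cycle.
\<close>

definition P :: "int \<Rightarrow> 'u \<Rightarrow> 'u" where
  "P p u = u - d (K p u) - K (p - 1) (d u)"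

text \<open>
  The symmetrization of \<open>\<mu>\<close>, symmetric for any two declared degrees.
\<close>

definition m :: "int \<Rightarrow> int \<Rightarrow> 'u \<Rightarrow> 'u \<Rightarrow> 'u" where
  "m p q u v = (1 / 2) *s (\<mu> u v + signed (p * q) (\<mu> v u))"

lemma lin_K: "lin (K p)"
  unfolding K_def by (rule lin_compose[OF lin_component g_linear])

lemma K_zero [simp]: "K p 0 = 0"
  by (rule linD(3)[OF lin_K])

lemma K_mem: "K p u \<in> U (p + 1)"
  unfolding K_def by (rule component(1))

text \<open>
  The degree-one part of \<open>g\<close> is still inverse to \<open>d\<close> on boundaries, since \<open>d\<close> commutes with taking
  components up to the shift.
\<close>

lemma d_K_d: "u \<in> U p \<Longrightarrow> d (K (p - 1) (d u)) = d u"
  using component_d[of "g (d u)" "p - 1"] component_of_mem[OF degree_d]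
  by (simp add: K_def d_g_d)

lemma lin_P: "lin (P p)"
  unfolding P_def by (intro lin_intros lin_compose[OF lin_d lin_K] lin_compose[OF lin_K lin_d])

lemma P_mem: "u \<in> U p \<Longrightarrow> P p u \<in> U p"
  unfolding P_def
  using K_mem[of "p - 1" "d u"] degree_d[OF K_mem[of p u]] by (intro U_intros) auto

lemma d_P [simp]: "u \<in> U p \<Longrightarrow> d (P p u) = 0"
  by (simp add: P_def d_K_d)

lemma P_d: "v \<in> U (p + 1) \<Longrightarrow> P p (d v) = 0"
  using d_K_d[of v "p + 1"] linD(3)[OF lin_K] by (simp add: P_def)

lemma lin_m: "lin (m p q u)" "lin (\<lambda>u. m p q u v)"
  unfolding m_def by (intro lin_intros lin_\<mu>)+

lemma m_zero [simp]: "m p q 0 v = 0" "m p q u 0 = 0"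
  using linD(3)[OF lin_m(1)] linD(3)[OF lin_m(2)] by auto

lemma m_mem: "u \<in> U p \<Longrightarrow> v \<in> U q \<Longrightarrow> m p q u v \<in> U (p + q)"
  unfolding m_def using \<mu>_mem[of u p v q] \<mu>_mem[of v q u p]
  by (intro U_intros) (simp_all add: add.commute)

lemma m_sym: "m p q u v = signed (p * q) (m q p v u)"
proof -
  have "signed (p * q + q * p) x = x" for x :: 'u by (simp add: signed_def mult.commute)
  then show ?thesis by (simp add: m_def signed_scale signed_add add.commute)
qed

lemma d_m:
  assumes "u \<in> U p" "v \<in> U q"
  shows "d (m p q u v) = m (p - 1) q (d u) v + signed p (m p (q - 1) u (d v))"
proof -
  have "d (\<mu> u v) = \<mu> (d u) v + signed p (\<mu> u (d v))"
    "d (\<mu> v u) = \<mu> (d v) u + signed q (\<mu> v (d u))"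
    using leibniz[OF assms(1), of v] leibniz[OF assms(2), of u] by (simp_all add: powi_scale)
  then show ?thesis
    by (cases "even p"; cases "even q")
      (simp_all add: m_def signed_def scale_right_distrib scale_right_diff_distrib)
qed

text \<open>
  The product of the homology, carried back to \<open>U\<close>.
\<close>

definition \<nu> :: "int \<Rightarrow> int \<Rightarrow> 'u \<Rightarrow> 'u \<Rightarrow> 'u" where
  "\<nu> p q u v = P (p + q) (m p q (P p u) (P q v))"

lemma lin_\<nu>: "lin (\<nu> p q u)" "lin (\<lambda>u. \<nu> p q u v)"
  unfolding \<nu>_def
  by (intro lin_compose[OF lin_P] lin_compose[OF lin_m(1) lin_P] lin_compose[OF lin_m(2) lin_P])+

lemma \<nu>_mem: "u \<in> U p \<Longrightarrow> v \<in> U q \<Longrightarrow> \<nu> p q u v \<in> U (p + q)"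
  unfolding \<nu>_def by (intro P_mem m_mem)

lemma \<nu>_sym: "\<nu> p q u v = signed (p * q) (\<nu> q p v u)"
  unfolding \<nu>_def by (subst m_sym) (simp add: linD(6)[OF lin_P] add.commute)

text \<open>
  On cycles the homotopy formula for \<open>h\<close> reduces to one boundary, and \<open>\<mu> - m\<close> is half of the
  commutator.
\<close>

lemma m_on_cycles:
  assumes a: "a \<in> U p" "d a = 0" and b: "b \<in> U q" "d b = 0"
  shows "m p q a b = \<mu> a b - d ((1 / 2) *s h a b)"
proof -
  have "d (h a b) = \<mu> a b - signed (p * q) (\<mu> b a)"
    using h_homotopy[OF a(1) b(1)] linD(3)[OF lin_h(1)] linD(3)[OF lin_h(2)]
    by (simp add: a b powi_scale)
  then have "m p q a b + d ((1 / 2) *s h a b) = (1 / 2) *s \<mu> a b + (1 / 2) *s \<mu> a b"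
    by (simp add: m_def scale_right_distrib scale_right_diff_distrib)
  also have "\<dots> = \<mu> a b" by (simp flip: scale_left_distrib)
  finally show ?thesis by (simp only: eq_diff_eq)
qed

lemma P_m_eq_P_\<mu>:
  assumes a: "a \<in> U p" "d a = 0" and b: "b \<in> U q" "d b = 0"
  shows "P (p + q) (m p q a b) = P (p + q) (\<mu> a b)"
proof -
  have "P (p + q) (d ((1 / 2) *s h a b)) = 0"
    by (intro P_d U_intros h_mem a b)
  then show ?thesis unfolding m_on_cycles[OF a b] linD(5)[OF lin_P] by simp
qed

text \<open>
  Replacing \<open>m\<close> by the associative \<open>\<mu>\<close>, first outside and then inside, changes values on cycles by
  boundaries only.
\<close>

lemma P_m_assoc:
  assumes a: "a \<in> U p" "d a = 0" and b: "b \<in> U q" "d b = 0" and c: "c \<in> U r" "d c = 0"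
  shows "P (p + q + r) (m (p + q) r (m p q a b) c) = P (p + q + r) (m p (q + r) a (m q r b c))"
proof -
  have dm: "d (m p q a b) = 0" "d (m q r b c) = 0"
    using d_m[OF a(1) b(1)] d_m[OF b(1) c(1)] by (simp_all add: a b c m_zero)
  obtain y where y: "y \<in> U (p + q + 1)" "m p q a b = \<mu> a b - d y"
    using m_on_cycles[OF a b] U_intros(3)[OF h_mem[OF a(1) b(1)]] by blast
  obtain z where z: "z \<in> U (q + r + 1)" "m q r b c = \<mu> b c - d z"
    using m_on_cycles[OF b c] U_intros(3)[OF h_mem[OF b(1) c(1)]] by blast
  have "P (p + q + r) (m (p + q) r (m p q a b) c) = P (p + q + r) (\<mu> (\<mu> a b - d y) c)"
    using P_m_eq_P_\<mu>[OF m_mem[OF a(1) b(1)] dm(1) c] y by simp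
  also have "\<dots> = P (p + q + r) (\<mu> (\<mu> a b) c) - P (p + q + r) (d (\<mu> y c))"
    using leibniz[OF y(1), of c] by (simp add: c linD[OF lin_\<mu>(2)] linD[OF lin_\<mu>(1)] linD[OF lin_P])
  also have "P (p + q + r) (d (\<mu> y c)) = 0"
    by (rule P_d) (use \<mu>_mem[OF y(1) c(1)] in \<open>simp add: ac_simps\<close>)
  finally have 1: "P (p + q + r) (m (p + q) r (m p q a b) c) = P (p + q + r) (\<mu> (\<mu> a b) c)" by simp
  have "P (p + (q + r)) (m p (q + r) a (m q r b c)) = P (p + (q + r)) (\<mu> a (\<mu> b c - d z))"
    using P_m_eq_P_\<mu>[OF a m_mem[OF b(1) c(1)] dm(2)] z by simp
  also have "\<dots> = P (p + (q + r)) (\<mu> a (\<mu> b c)) - P (p + (q + r)) (d (signed p (\<mu> a z)))"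
    using leibniz[OF a(1), of z]
    by (simp add: a linD[OF lin_\<mu>(2)] linD[OF lin_\<mu>(1)] linD[OF lin_P] powi_scale signed_def)
  also have "P (p + (q + r)) (d (signed p (\<mu> a z))) = 0"
    by (rule P_d) (use \<mu>_mem[OF a(1) z(1)] in \<open>simp add: ac_simps\<close>)
  finally show ?thesis using 1 by (simp add: assoc add.assoc)
qed

lemma P_P:
  assumes "x \<in> U p" "d x = 0"
  shows "P p (P p x) = x - d (K p x)"
proof -
  have "P p x = x - d (K p x)" using assms linD(3)[OF lin_K] by (simp add: P_def)
  moreover have "P p (d (K p x)) = 0" by (rule P_d[OF K_mem])
  ultimately show ?thesis by (simp add: linD(5)[OF lin_P])
qed

text \<open>
  The inner product enters through \<open>P P x = x - d (K x)\<close>, a change by a boundary, which the outer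
  \<open>P\<close> kills after multiplication with a cycle.
\<close>

lemma \<nu>_assoc:
  assumes u: "u \<in> U p" and v: "v \<in> U q" and w: "w \<in> U r"
  shows "\<nu> (p + q) r (\<nu> p q u v) w = \<nu> p (q + r) u (\<nu> q r v w)"
proof -
  let ?a = "P p u" and ?b = "P q v" and ?c = "P r w"
  have a: "?a \<in> U p" "d ?a = 0" and b: "?b \<in> U q" "d ?b = 0" and c: "?c \<in> U r" "d ?c = 0"
    using u v w by (simp_all add: P_mem)
  let ?x = "m p q ?a ?b" and ?y = "m q r ?b ?c"
  have x: "?x \<in> U (p + q)" "d ?x = 0" and y: "?y \<in> U (q + r)" "d ?y = 0"
    using m_mem[OF a(1) b(1)] m_mem[OF b(1) c(1)] d_m[OF a(1) b(1)] d_m[OF b(1) c(1)] a b c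
    by (simp_all add: m_zero)
  have "\<nu> (p + q) r (\<nu> p q u v) w = P (p + q + r) (m (p + q) r (?x - d (K (p + q) ?x)) ?c)"
    by (simp add: \<nu>_def P_P[OF x])
  also have "m (p + q) r (?x - d (K (p + q) ?x)) ?c
      = m (p + q) r ?x ?c - d (m (p + q + 1) r (K (p + q) ?x) ?c)"
    using d_m[OF K_mem[of "p + q" ?x] c(1)] c(2) by (simp add: linD(5)[OF lin_m(2)] m_zero)
  also have "P (p + q + r) \<dots> = P (p + q + r) (m (p + q) r ?x ?c)"
    using P_d[of "m (p + q + 1) r (K (p + q) ?x) ?c" "p + q + r"] m_mem[OF K_mem[of "p + q" ?x] c(1)]
    by (simp add: linD(5)[OF lin_P] ac_simps)
  also have "\<dots> = P (p + q + r) (m p (q + r) ?a ?y)"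
    by (rule P_m_assoc[OF a b c])
  also have "\<dots> = P (p + (q + r)) (m p (q + r) ?a ?y - d (signed p (m p (q + r + 1) ?a (K (q + r) ?y))))"
    using P_d[of "signed p (m p (q + r + 1) ?a (K (q + r) ?y))" "p + (q + r)"]
      m_mem[OF a(1) K_mem[of "q + r" ?y]]
    by (simp add: linD(5)[OF lin_P] ac_simps del: d_simps(5))
  also have "m p (q + r) ?a ?y - d (signed p (m p (q + r + 1) ?a (K (q + r) ?y)))
      = m p (q + r) ?a (?y - d (K (q + r) ?y))"
    using d_m[OF a(1) K_mem[of "q + r" ?y]] a(2)
    by (simp add: linD(5)[OF lin_m(1)] m_zero) (simp add: signed_def)
  also have "P (p + (q + r)) \<dots> = \<nu> p (q + r) u (\<nu> q r v w)"
    by (simp add: \<nu>_def P_P[OF y])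
  finally show ?thesis .
qed

text \<open>
  The homotopy from \<open>m\<close> to \<open>\<nu>\<close> replaces the two arguments and then the value by their images under
  \<open>P\<close>, one after the other.
\<close>

definition G0 :: "int \<Rightarrow> int \<Rightarrow> 'u \<Rightarrow> 'u \<Rightarrow> 'u" where
  "G0 p q u v = m (p + 1) q (K p u) v + signed p (m p (q + 1) (P p u) (K q v))
    + K (p + q) (m p q (P p u) (P q v))"

lemma lin_G0: "lin (G0 p q u)" "lin (\<lambda>u. G0 p q u v)"
  unfolding G0_def
  by (intro lin_intros lin_compose[OF lin_K] lin_compose[OF lin_m(1) lin_P] lin_compose[OF lin_m(2) lin_P]
      lin_compose[OF lin_m(1) lin_K] lin_compose[OF lin_m(2) lin_K] lin_m)+

lemma G0_mem: "u \<in> U p \<Longrightarrow> v \<in> U q \<Longrightarrow> G0 p q u v \<in> U (p + q + 1)"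
  unfolding G0_def
  using m_mem[OF K_mem[of p u], of v q] m_mem[OF P_mem K_mem[of q v], of u p] K_mem[of "p + q"]
  by (intro U_intros) (simp_all add: ac_simps)

lemma \<delta>_G0:
  assumes u: "u \<in> U p" and v: "v \<in> U q"
  shows "d (G0 p q u v) + (G0 (p - 1) q (d u) v + signed p (G0 p (q - 1) u (d v)))
    = m p q u v - \<nu> p q u v"
proof -
  let ?x = "m p q (P p u) (P q v)"
  have Pd: "P (p - 1) (d u) = 0" "P (q - 1) (d v) = 0"
    using P_d[of u "p - 1"] P_d[of v "q - 1"] u v by simp_all
  have "d ?x = 0" using d_m[OF P_mem[OF u] P_mem[OF v]] u v by (simp add: m_zero)
  then have x: "d (K (p + q) ?x) = ?x - \<nu> p q u v"
    by (simp add: \<nu>_def P_def[of "p + q"] m_zero)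
  have 1: "d (m (p + 1) q (K p u) v) = m p q (d (K p u)) v - signed p (m (p + 1) (q - 1) (K p u) (d v))"
    using d_m[OF K_mem[of p u] v] by (simp add: signed_def)
  have 2: "d (signed p (m p (q + 1) (P p u) (K q v))) = m p q (P p u) (d (K q v))"
    using d_m[OF P_mem[OF u] K_mem[of q v]] u by (simp add: m_zero) (simp add: signed_def)
  have 3: "G0 (p - 1) q (d u) v = m p q (K (p - 1) (d u)) v"
    by (simp add: G0_def Pd m_zero)
  have 4: "signed p (G0 p (q - 1) u (d v)) = signed p (m (p + 1) (q - 1) (K p u) (d v))
      + m p q (P p u) (K (q - 1) (d v))"
    by (simp add: G0_def Pd m_zero signed_add) (simp add: signed_def)
  have 5: "m p q (d (K p u)) v + m p q (K (p - 1) (d u)) v = m p q u v - m p q (P p u) v"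
    by (simp add: P_def linD[OF lin_m(2)])
  have 6: "m p q (P p u) (d (K q v)) + m p q (P p u) (K (q - 1) (d v))
      = m p q (P p u) v - ?x"
    by (simp add: P_def[of q] linD[OF lin_m(1)])
  have "d (G0 p q u v) + (G0 (p - 1) q (d u) v + signed p (G0 p (q - 1) u (d v)))
     = (m p q (d (K p u)) v + m p q (K (p - 1) (d u)) v)
      + (m p q (P p u) (d (K q v)) + m p q (P p u) (K (q - 1) (d v))) + d (K (p + q) ?x)"
    unfolding 3 4 unfolding G0_def d_simps(1) 1 2 by (simp add: algebra_simps)
  then show ?thesis unfolding 5 6 x by simp
qed

text \<open>
  Symmetrization preserves the differential \<open>m - \<nu>\<close> of \<open>G0\<close>, since \<open>m\<close> and \<open>\<nu>\<close> are symmetric.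
\<close>

definition G :: "int \<Rightarrow> int \<Rightarrow> 'u \<Rightarrow> 'u \<Rightarrow> 'u" where
  "G p q u v = (1 / 2) *s (G0 p q u v + signed (p * q) (G0 q p v u))"

lemma lin_G: "lin (G p q u)" "lin (\<lambda>u. G p q u v)"
  unfolding G_def by (intro lin_intros lin_G0)+

lemma G_mem: "u \<in> U p \<Longrightarrow> v \<in> U q \<Longrightarrow> G p q u v \<in> U (p + q + 1)"
  unfolding G_def using G0_mem[of v q u p] G0_mem[of u p v q]
  by (intro U_intros) (simp_all add: ac_simps)

lemma G_sym: "G p q u v = signed (p * q) (G q p v u)"
proof -
  have "signed (p * q + q * p) x = x" for x :: 'u by (simp add: signed_def mult.commute)
  then show ?thesis by (simp add: G_def signed_scale signed_add add.commute)
qed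

lemma \<delta>_G:
  assumes u: "u \<in> U p" and v: "v \<in> U q"
  shows "d (G p q u v) + (G (p - 1) q (d u) v + signed p (G p (q - 1) u (d v)))
    = m p q u v - \<nu> p q u v"
proof -
  have s: "signed (q * (p - 1)) x = signed (q + p * q) x"
    "signed (p + p * (q - 1)) x = signed (p * q) x" for x :: 'u
    by (rule signed_cong, simp add: algebra_simps)+
  have "d (G p q u v) + (G (p - 1) q (d u) v + signed p (G p (q - 1) u (d v)))
    = (1 / 2) *s ((d (G0 p q u v) + (G0 (p - 1) q (d u) v + signed p (G0 p (q - 1) u (d v))))
      + signed (p * q) (d (G0 q p v u) + (G0 (q - 1) p (d v) u + signed q (G0 q (p - 1) v (d u)))))"
    by (simp add: G_def signed_scale signed_add s ac_simps flip: scale_right_distrib)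
  also have "\<dots> = (1 / 2) *s ((m p q u v - \<nu> p q u v) + (m p q u v - \<nu> p q u v))"
    unfolding \<delta>_G0[OF u v] \<delta>_G0[OF v u] signed_diff m_sym[of p q u v, symmetric]
      \<nu>_sym[of p q u v, symmetric] ..
  also have "\<dots> = m p q u v - \<nu> p q u v"
    by (simp only: scale_right_distrib) (simp flip: scale_left_distrib)
  finally show ?thesis .
qed

text \<open>
  The three words that matter express that \<open>d\<close> squares to zero, that \<open>\<nu>\<close> is annihilated by \<open>d\<close> on
  either side, and that \<open>\<nu>\<close> is associative.
\<close>

lemma strict_square:
  assumes "hom_word ws"
  shows "coderiv (-1) (cochain_upto_2 d \<nu>) (cochain_upto_2 d \<nu>) ws = 0"
proof -
  have L: "slot_linear (cochain_upto_2 d \<nu>)"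
    by (intro slot_linear_cochain_upto_2 lin_d lin_\<nu>)
  have \<nu>_d: "\<nu> p q (d u) v = 0" if "u \<in> U (p + 1)" for p q u v
    using P_d[OF that] linD(3)[OF lin_m(2)] linD(3)[OF lin_P] by (simp add: \<nu>_def)
  have \<nu>_d': "\<nu> p q u (d v) = 0" if "v \<in> U (q + 1)" for p q u v
    using P_d[OF that] linD(3)[OF lin_m(1)] linD(3)[OF lin_P] by (simp add: \<nu>_def)
  have d_\<nu>: "d (\<nu> p q u v) = 0" if "u \<in> U p" "v \<in> U q" for p q u v
    unfolding \<nu>_def by (intro d_P m_mem P_mem that)
  consider "ws = []" | x where "ws = [x]" | x y where "ws = [x, y]" | x y z where "ws = [x, y, z]"
    | "4 \<le> length ws"
    by (cases ws; cases "tl ws"; cases "tl (tl ws)"; cases "tl (tl (tl ws))") auto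
  then show ?thesis
  proof cases
    case (2 x)
    then show ?thesis by (simp add: out_def)
  next
    case (3 x y)
    then show ?thesis
      using assms by (simp add: out_def \<nu>_d \<nu>_d' d_\<nu>)
  next
    case (4 x y z)
    define p q r where "p = fst x - 1" and "q = fst y - 1" and "r = fst z - 1"
    have f: "fst x = p + 1" "fst y = q + 1" "fst z = r + 1" by (simp_all add: p_def q_def r_def)
    have mem: "snd x \<in> U p" "snd y \<in> U q" "snd z \<in> U r"
      using assms 4 by (simp_all add: p_def q_def r_def)
    have "coderiv (-1) (cochain_upto_2 d \<nu>) (cochain_upto_2 d \<nu>) ws
        = signed (p + q + p) (\<nu> (p + q) r (\<nu> p q (snd x) (snd y)) (snd z))
        + signed (- (p + 1) + p + q) (\<nu> p (q + r) (snd x) (\<nu> q r (snd y) (snd z)))"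
      unfolding 4
      by (simp add: out_def f linD(6)[OF lin_\<nu>(1)] linD(6)[OF lin_\<nu>(2)] ac_simps)
    also have "\<dots> = 0"
      unfolding \<nu>_assoc[OF mem] by (simp add: signed_def)
    finally show ?thesis .
  next
    case 5
    show ?thesis
    proof (rule coderiv_eq_0)
      fix a u b assume s: "ws = a @ u @ b" "u \<noteq> []"
      show "cochain_upto_2 d \<nu> (a @ out (-1) (cochain_upto_2 d \<nu>) u # b) = 0"
      proof (cases "3 \<le> length u")
        case True
        then show ?thesis by (intro slot_linear_zero[OF L] cochain_upto_2_long)
      next
        case False
        then show ?thesis using s 5 by (intro cochain_upto_2_long) simp
      qed
    qed
  qed simp
qed

sublocale gauge scale U "cochain_upto_2 d \<nu>" "cochain_upto_2 (\<lambda>u. 0) G"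
proof
  show "slot_linear (cochain_upto_2 d \<nu>)" by (intro slot_linear_cochain_upto_2 lin_d lin_\<nu>)
  show "slot_linear (cochain_upto_2 (\<lambda>u. 0) G)" by (intro slot_linear_cochain_upto_2 lin_G lin_intros)
  show "graded_cochain (-1) (cochain_upto_2 d \<nu>)"
    using degree_d \<nu>_mem by (intro graded_cochain_upto_2) auto
  show "graded_cochain 0 (cochain_upto_2 (\<lambda>u. 0) G)"
    using G_mem by (intro graded_cochain_upto_2) (auto simp: subspace_0[OF subspace_component])
  show "shuffle_free (cochain_upto_2 d \<nu>)" by (rule shuffle_free_cochain_upto_2) (rule \<nu>_sym)
  show "shuffle_free (cochain_upto_2 (\<lambda>u. 0) G)" by (rule shuffle_free_cochain_upto_2) (rule G_sym)
  show "cochain_upto_2 (\<lambda>u. 0) G ws = 0" if "length ws \<le> 1" for ws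
    using that by (cases ws) auto
qed (simp_all add: strict_square)

text \<open>
  The bracket of the differential with \<open>G\<close> is the differential \<open>m - \<nu>\<close> of \<open>G\<close>, which turns \<open>\<nu>\<close>
  into \<open>m\<close>.
\<close>

lemma transform_binary:
  assumes u: "u \<in> U p" and v: "v \<in> U q"
  shows "transform [(p + 1, u), (q + 1, v)] = signed p (m p q u v)"
proof -
  have "signed p (m p q u v) = signed p (\<nu> p q u v)
      + signed p (d (G p q u v) + (G (p - 1) q (d u) v + signed p (G p (q - 1) u (d v))))"
    unfolding \<delta>_G[OF u v] by (simp flip: signed_add)
  moreover have "signed (p - 1) x = - signed p x" "signed (- 1 + p) x = - signed p x"
    "signed (- 1) x = - x" for x :: 'u
    by (auto simp: signed_def)
  ultimately show ?thesis
    by (simp add: transform_pair out_def signed_add linD(3)[OF lin_\<nu>(1)] linD(3)[OF lin_\<nu>(2)])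
      (simp add: signed_def)
qed

theorem balanced_A_infinity_transform: "balanced_A_infinity_algebra scale U d (desuspend transform)"
proof -
  have "A_infinity_algebra scale U d (desuspend transform)"
    by (intro A_infinity_desuspend transform_linear transform_graded transform_square)
      (simp_all add: transform_single)
  then show ?thesis
    unfolding balanced_A_infinity_algebra_def balanced_A_infinity_algebra_axioms_def
    using balanced_desuspend[OF transform_linear transform_shuffle] by blast
qed

lemma desuspend_transform_binary:
  assumes u: "u \<in> U p" and v: "v \<in> U q"
  shows "desuspend transform 2 [u, v] = symmetrization scale \<mu> p q u v"
proof -
  have "homogeneous [p, q] [u, v]" using u v by (simp add: homogeneous_def)
  then have "desuspend transform 2 [u, v] = signed p (signed p (m p q u v))"
    by (simp add: desuspend_homogeneous[OF transform_linear] tag_def transform_binary[OF u v])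
  also have "\<dots> = m p q u v" by (simp add: signed_def)
  finally show ?thesis by (simp add: m_def symmetrization_def powi_scale)
qed

end

text \<open>
  A generalized inverse of the differential and a homotopy of commutativity provide the data of a
  contraction.
\<close>

theorem corollary17:
  fixes scale :: "'k::field_char_0 \<Rightarrow> 'u::ab_group_add \<Rightarrow> 'u"
    and U :: "int \<Rightarrow> 'u set"
    and d :: "'u \<Rightarrow> 'u"
    and \<mu> :: "'u \<Rightarrow> 'u \<Rightarrow> 'u"
  assumes "homotopy_commutative_dg_algebra scale U d \<mu>"
  shows "\<exists>n. balanced_A_infinity_algebra scale U d n \<and>
    (\<forall>p q. \<forall>u\<in>U p. \<forall>v\<in>U q. n 2 [u, v] = symmetrization scale \<mu> p q u v)"
proof -
  interpret homotopy_commutative_dg_algebra scale U d \<mu> by (rule assms)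
  obtain g where g: "lin g" "\<And>x. d (g (d x)) = d x" using generalized_inverse by blast
  obtain h where h: "graded_bilinear 1 h"
    "\<And>p q u v. u \<in> U p \<Longrightarrow> v \<in> U q \<Longrightarrow> d (h u v) + (h (d u) v + scale ((-1) powi p) (h u (d v)))
      = \<mu> u v - scale ((-1) powi (p * q)) (\<mu> v u)"
    using homotopy_commutative by blast
  interpret contraction scale U d \<mu> g h
    by (intro contraction.intro contraction_axioms.intro associative_dg_algebra_axioms g h)
  show ?thesis using balanced_A_infinity_transform desuspend_transform_binary by blast
qed

end
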